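(* Let $G$ be a finite-dimensional Lie group with Lie algebra $\mathfrak g$, $\tau:\mathfrak g\to G$ a retraction map, $h,h_1,\dots,h_N:G\times\mathfrak g^*\to\mathbb R$ smooth, and let $F_{0,T}:T^*G\to T^*G$, $F_{0,T}(g_0,p_0)=(g_M,p_M)$, be the discrete stochastic flow of the stochastic midpoint Lie group method with the endpoint momenta defined by the generating property (both as described in the context). Then $F_{0,T}$ is symplectic: it preserves the canonical symplectic form $\Omega_{T^*G}=\mathrm dg\wedge\mathrm dp$ of $T^*G$, that is $$(F_{0,T})^*\Omega_{T^*G}=\Omega_{T^*G}.$$
   Context: Conventions. A retraction map $\tau:\mathfrak g\to G$ is a local diffeomorphism (near $0$) with $\tau(0)=e$. For $\xi,\eta\in\mathfrak g$, $g=\tau(\xi)$: $\mathrm d_\xi\tau^{-1}(\eta):=\mathrm D\tau^{-1}(g)\cdot(\eta g)$, with dual $[\mathrm d_\xi\tau^{-1}]^*:\mathfrak g^*\to\mathfrak g^*$. $\langle\mathrm{Ad}^*_g\mu,\eta\rangle=\langle\mu,\mathrm{Ad}_g\eta\rangle$. For $\alpha\in T^*_gG$, $g^{-1}\alpha\in\mathfrak g^*$ is the left translate, and for $\mu\in\mathfrak g^*$, $g\mu\in T_g^*G$ is the inverse operation. Discrete action. Let $\Delta t>0$, $M\ge1$, $T=M\Delta t$, and $\Delta W^i_k$ ($k=1,\dots,M$) the increments of independent Wiener processes $W_i$ over the $k$-th step; everything is pathwise. For discrete curves $c_d=(g_0,\tilde g_1,\tilde\mu^1_1,\tilde\mu^2_1,g_1,\dots,\tilde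 g_M,\tilde\mu^1_M,\tilde\mu^2_M,g_M)$ with $g_k,\tilde g_k\in G$, $\tilde\mu^1_k,\tilde\mu^2_k\in\mathfrak g^*$, set $$\mathcal G_d(c_d)=\sum_{k=1}^{M}\Delta t\Big[\Big\langle\tilde\mu^2_{k},\tfrac{\tau^{-1}(\tilde g_{k}^{-1}g_{k})}{\Delta t}\Big\rangle+\Big\langle\tilde\mu^1_{k},\tfrac{\tau^{-1}(g_{k-1}^{-1}\tilde g_{k})}{\Delta t}\Big\rangle-\mathsf h_k\Big(\tilde g_{k},\tfrac{\tilde\mu^1_{k}+\tilde\mu^2_{k}}2\Big)\Big],\quad \mathsf h_k:=h+\sum_{i=1}^N h_i\tfrac{\Delta W^i_k}{\Delta t}.$$ Scheme. The condition $\mathrm d\mathcal G_d(c_d)\cdot\delta c_d=0$ with $\delta g_0=\delta g_M=0$ is the stochastic midpoint Lie group method: with $\Delta t\,\xi_k=\tau^{-1}(\tilde g_k^{-1}g_k)$, $\Delta t\,\tilde\xi_k=\tau^{-1}(g_{k-1}^{-1}\tilde g_k)$ and derivatives of $\mathsf h_k$ evaluated at $(\tilde g_k,\frac{\tilde\mu^1_k+\tilde\mu^2_k}2)$, $$\tfrac1{\Delta t}\big(\mathrm{Ad}^*_{\tau(\Delta t\tilde\xi_k)}[\mathrm d_{\Delta t\tilde\xi_k}\tau^{-1}]^*\tilde\mu^1_k-[\mathrm d_{\Delta t\xi_k}\tau^{-1}]^*\tilde\mu^2_k\big)=\tilde g_k^{-1}\tfrac{\partial\mathsf h_k}{\partial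 g},\qquad \tilde\xi_k=\xi_k=\tfrac12\tfrac{\partial\mathsf h_k}{\partial\mu}\quad(k=1,\dots,M),$$ $$\mathrm{Ad}^*_{\tau(\Delta t\xi_k)}[\mathrm d_{\Delta t\xi_k}\tau^{-1}]^*\tilde\mu^2_k=[\mathrm d_{\Delta t\tilde\xi_{k+1}}\tau^{-1}]^*\tilde\mu^1_{k+1}\quad(k=1,\dots,M-1).$$ Endpoint momenta. Let $\mathcal S_d(g_0,g_M)=\mathcal G_d(\bar c_d(g_0,g_M))$, where $\bar c_d(g_0,g_M)$ is the critical discrete curve with endpoints $g_0,g_M$. Define $p_0:=-\partial\mathcal S_d/\partial g_0\in T^*_{g_0}G$ and $p_M:=\partial\mathcal S_d/\partial g_M\in T^*_{g_M}G$; equivalently $p_0=g_0[\mathrm d_{\Delta t\tilde\xi_1}\tau^{-1}]^*\tilde\mu^1_1$ and $p_M=g_M\mathrm{Ad}^*_{\tau(\Delta t\xi_M)}[\mathrm d_{\Delta t\xi_M}\tau^{-1}]^*\tilde\mu^2_M$. Standing assumption: the critical curve exists and depends smoothly on $(g_0,g_M)$ (so $\mathcal S_d$ is smooth), all arguments of $\tau^{-1}$ lie where $\tau^{-1}$ is a diffeomorphism, and the equations determine the smooth map $F_{0,T}:(g_0,p_0)\mapsto(g_M,p_M)$ (if only locally, the statement is understood on its domain). *)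

theory Defs
  imports "HOL-Probability.Probability"
begin

section \<open>Smooth maps between normed spaces\<close>

text \<open>On an open set of a finite-dimensional space this is the usual class \<open>C^k\<close>: all iterated
  directional derivatives up to order \<open>k\<close> exist as Frechet derivatives and are continuous.\<close>

primrec Ck_on :: "nat \<Rightarrow> 'a::real_normed_vector set \<Rightarrow> ('a \<Rightarrow> 'b::real_normed_vector) \<Rightarrow> bool" where
  "Ck_on 0 S f \<longleftrightarrow> continuous_on S f"
| "Ck_on (Suc k) S f \<longleftrightarrow>
     (\<forall>x\<in>S. f differentiable (at x)) \<and> (\<forall>v. Ck_on k S (\<lambda>x. frechet_derivative f (at x) v))"

definition smooth_on :: "'a::real_normed_vector set \<Rightarrow> ('a \<Rightarrow> 'b::real_normed_vector) \<Rightarrow> bool" where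
  "smooth_on S f \<longleftrightarrow> (\<forall>k. Ck_on k S f)"


section \<open>Smooth manifolds given by an atlas\<close>

text \<open>The underlying set of a manifold is a whole type \<open>'m\<close>. Its topology is the one induced by the
  atlas, not a type class topology (the product topology on the type that carries the cotangent
  bundle below would be the wrong one).\<close>

type_synonym ('m, 'e) chart = "'m set \<times> ('m \<Rightarrow> 'e)"

definition chart_inv :: "('m, 'e) chart \<Rightarrow> 'e \<Rightarrow> 'm" where
  "chart_inv c = inv_into (fst c) (snd c)"

definition manifold_topology :: "('m, 'e::real_normed_vector) chart set \<Rightarrow> 'm topology" where
  "manifold_topology A = topology (\<lambda>X. \<forall>c\<in>A. open (snd c ` (X \<inter> fst c)))"

definition smooth_manifold :: "('m, 'e::real_normed_vector) chart set \<Rightarrow> bool" where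
  "smooth_manifold A \<longleftrightarrow>
     (\<Union>c\<in>A. fst c) = UNIV \<and>
     (\<forall>c\<in>A. inj_on (snd c) (fst c) \<and> open (snd c ` fst c)) \<and>
     (\<forall>c\<in>A. \<forall>d\<in>A. open (snd c ` (fst c \<inter> fst d)) \<and>
        smooth_on (snd c ` (fst c \<inter> fst d)) (snd d \<circ> chart_inv c)) \<and>
     Hausdorff_space (manifold_topology A) \<and>
     second_countable (manifold_topology A)"

definition model_atlas :: "('e, 'e) chart set" where
  "model_atlas = {(UNIV, id)}"

definition prod_atlas :: "('m, 'e) chart set \<Rightarrow> ('n, 'f) chart set \<Rightarrow> ('m \<times> 'n, 'e \<times> 'f) chart set" where
  "prod_atlas A B = (\<lambda>(c, d). (fst c \<times> fst d, map_prod (snd c) (snd d))) ` (A \<times> B)"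

text \<open>The openness clause expresses continuity of \<open>f\<close> on \<open>S\<close>; it also forces \<open>S\<close> to be open.\<close>

definition smooth_map_on ::
  "('m, 'e::real_normed_vector) chart set \<Rightarrow> ('n, 'f::real_normed_vector) chart set
    \<Rightarrow> 'm set \<Rightarrow> ('m \<Rightarrow> 'n) \<Rightarrow> bool" where
  "smooth_map_on A B S f \<longleftrightarrow>
     (\<forall>c\<in>A. \<forall>d\<in>B. let X = snd c ` (S \<inter> fst c \<inter> f -` fst d)
        in open X \<and> smooth_on X (snd d \<circ> f \<circ> chart_inv c))"


section \<open>Tangent and cotangent vectors\<close>

text \<open>Every point \<open>x\<close> has a chosen chart \<open>chart_at A x\<close>, and the tangent space at \<open>x\<close> is identified
  with the model space \<open>'e\<close> through the differential of that chart. Under this identification the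
  tangent map at \<open>x\<close> is the Frechet derivative of the coordinate expression in the chosen charts
  at \<open>x\<close> and \<open>f x\<close>, and a covector at \<open>x\<close> is an element of \<open>'e \<Rightarrow>\<^sub>L real\<close>.\<close>

definition chart_at :: "('m, 'e) chart set \<Rightarrow> 'm \<Rightarrow> ('m, 'e) chart" where
  "chart_at A x = (SOME c. c \<in> A \<and> x \<in> fst c)"

definition tangent_map ::
  "('m, 'e::real_normed_vector) chart set \<Rightarrow> ('n, 'f::real_normed_vector) chart set
    \<Rightarrow> ('m \<Rightarrow> 'n) \<Rightarrow> 'm \<Rightarrow> 'e \<Rightarrow> 'f" where
  "tangent_map A B f x =
     frechet_derivative (snd (chart_at B (f x)) \<circ> f \<circ> chart_inv (chart_at A x))
       (at (snd (chart_at A x) x))"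

definition differential ::
  "('m, 'e::real_normed_vector) chart set \<Rightarrow> ('m \<Rightarrow> real) \<Rightarrow> 'm \<Rightarrow> 'e \<Rightarrow>\<^sub>L real" where
  "differential A f x = Blinfun (tangent_map A model_atlas f x)"

definition pullback_form ::
  "('m, 'e::real_normed_vector) chart set \<Rightarrow> ('n, 'f::real_normed_vector) chart set
    \<Rightarrow> ('m \<Rightarrow> 'n) \<Rightarrow> ('n \<Rightarrow> 'f \<Rightarrow> 'f \<Rightarrow> real) \<Rightarrow> 'm \<Rightarrow> 'e \<Rightarrow> 'e \<Rightarrow> real" where
  "pullback_form A B f \<omega> x u v = \<omega> (f x) (tangent_map A B f x u) (tangent_map A B f x v)"


section \<open>The cotangent bundle and its canonical symplectic form\<close>

text \<open>A point of the cotangent bundle is a pair \<open>(g, \<alpha>)\<close> with \<open>\<alpha>\<close> a covector at \<open>g\<close>. A chart \<open>c\<close> of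
  the base induces canonical coordinates \<open>(q, p)\<close>: \<open>q\<close> is the coordinate vector of \<open>g\<close>, and \<open>p\<close> is
  the pullback of \<open>\<alpha>\<close> along the inverse of \<open>c\<close>, i.e. the components of \<open>\<alpha>\<close> with respect to \<open>dq\<close>.\<close>

definition cotangent_chart ::
  "('m, 'e::real_normed_vector) chart set \<Rightarrow> ('m, 'e) chart
    \<Rightarrow> ('m \<times> ('e \<Rightarrow>\<^sub>L real), 'e \<times> ('e \<Rightarrow>\<^sub>L real)) chart" where
  "cotangent_chart A c =
     (fst c \<times> UNIV,
      \<lambda>(g, \<alpha>). (snd c g, \<alpha> o\<^sub>L Blinfun (tangent_map model_atlas A (chart_inv c) (snd c g))))"

definition cotangent_atlas ::
  "('m, 'e::real_normed_vector) chart set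
    \<Rightarrow> ('m \<times> ('e \<Rightarrow>\<^sub>L real), 'e \<times> ('e \<Rightarrow>\<^sub>L real)) chart set" where
  "cotangent_atlas A = cotangent_chart A ` A"

definition dq_wedge_dp ::
  "'e \<times> ('e::real_normed_vector \<Rightarrow>\<^sub>L real) \<Rightarrow> 'e \<times> ('e \<Rightarrow>\<^sub>L real) \<Rightarrow> real" where
  "dq_wedge_dp u v = blinfun_apply (snd v) (fst u) - blinfun_apply (snd u) (fst v)"

text \<open>The form is given by \<open>dq \<and> dp\<close> in canonical coordinates around \<open>z\<close>.\<close>

definition canonical_symplectic_form ::
  "('m, 'e::real_normed_vector) chart set \<Rightarrow> 'm \<times> ('e \<Rightarrow>\<^sub>L real)
    \<Rightarrow> 'e \<times> ('e \<Rightarrow>\<^sub>L real) \<Rightarrow> 'e \<times> ('e \<Rightarrow>\<^sub>L real) \<Rightarrow> real" where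
  "canonical_symplectic_form A z =
     pullback_form (cotangent_atlas A) model_atlas
       (snd (chart_at (cotangent_atlas A) z)) (\<lambda>_. dq_wedge_dp) z"


section \<open>Lie groups and retraction maps\<close>

record ('g, 'e) lie_group_data =
  atlas :: "('g, 'e) chart set"
  mult :: "'g \<Rightarrow> 'g \<Rightarrow> 'g"
  unit :: 'g
  inverse_of :: "'g \<Rightarrow> 'g"

definition lie_group :: "('g, 'e::euclidean_space) lie_group_data \<Rightarrow> bool" where
  "lie_group G \<longleftrightarrow>
     smooth_manifold (atlas G) \<and>
     group (mult G) (unit G) (inverse_of G) \<and>
     smooth_map_on (prod_atlas (atlas G) (atlas G)) (atlas G) UNIV (\<lambda>(a, b). mult G a b) \<and>
     smooth_map_on (atlas G) (atlas G) UNIV (inverse_of G)"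

text \<open>The Lie algebra is the tangent space at the unit, hence the type \<open>'e\<close>, and its dual is
  \<open>'e \<Rightarrow>\<^sub>L real\<close>. The open set \<open>U\<close> is a neighbourhood of \<open>0\<close> on which \<open>\<tau>\<close> is a diffeomorphism onto
  the open set \<open>\<tau> ` U\<close>; the inverse \<open>\<tau>\<^sup>-\<^sup>1\<close> of the discrete action is the inverse of this restriction.\<close>

definition lie_retraction ::
  "('g, 'e::euclidean_space) lie_group_data \<Rightarrow> ('e \<Rightarrow> 'g) \<Rightarrow> 'e set \<Rightarrow> bool" where
  "lie_retraction G \<tau> U \<longleftrightarrow>
     open U \<and> 0 \<in> U \<and> \<tau> 0 = unit G \<and> inj_on \<tau> U \<and>
     openin (manifold_topology (atlas G)) (\<tau> ` U) \<and>
     smooth_map_on model_atlas (atlas G) U \<tau> \<and>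
     smooth_map_on (atlas G) model_atlas (\<tau> ` U) (inv_into U \<tau>)"


section \<open>Wiener processes\<close>

definition wiener_process :: "'w measure \<Rightarrow> (real \<Rightarrow> 'w \<Rightarrow> real) \<Rightarrow> bool" where
  "wiener_process P W \<longleftrightarrow>
     (\<forall>t\<ge>0. W t \<in> borel_measurable P) \<and>
     (AE \<omega> in P. W 0 \<omega> = 0) \<and>
     (AE \<omega> in P. continuous_on {0..} (\<lambda>t. W t \<omega>)) \<and>
     (\<forall>s t. 0 \<le> s \<longrightarrow> s < t \<longrightarrow>
        distributed P lborel (\<lambda>\<omega>. W t \<omega> - W s \<omega>) (normal_density 0 (sqrt (t - s)))) \<and>
     (\<forall>(t :: nat \<Rightarrow> real) n. mono t \<longrightarrow> 0 \<le> t 0 \<longrightarrow>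
        prob_space.indep_vars P (\<lambda>_. borel) (\<lambda>j \<omega>. W (t (Suc j)) \<omega> - W (t j) \<omega>) {..<n})"

definition independent_wiener_processes ::
  "'w measure \<Rightarrow> nat \<Rightarrow> (nat \<Rightarrow> real \<Rightarrow> 'w \<Rightarrow> real) \<Rightarrow> bool" where
  "independent_wiener_processes P N W \<longleftrightarrow>
     (\<forall>i\<in>{1..N}. wiener_process P (W i)) \<and>
     prob_space.indep_vars P (\<lambda>_. \<Pi>\<^sub>M t\<in>{0..}. borel) (\<lambda>i \<omega>. \<lambda>t\<in>{0..}. W i t \<omega>) {1..N}"

definition wiener_increment ::
  "(nat \<Rightarrow> real \<Rightarrow> 'w \<Rightarrow> real) \<Rightarrow> real \<Rightarrow> 'w \<Rightarrow> nat \<Rightarrow> nat \<Rightarrow> real" where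
  "wiener_increment W \<Delta>t \<omega> i k = W i (real k * \<Delta>t) \<omega> - W i ((real k - 1) * \<Delta>t) \<omega>"


section \<open>The discrete action and its critical curves\<close>

definition stochastic_hamiltonian ::
  "('g \<times> 'd \<Rightarrow> real) \<Rightarrow> (nat \<Rightarrow> 'g \<times> 'd \<Rightarrow> real) \<Rightarrow> nat \<Rightarrow> real \<Rightarrow> (nat \<Rightarrow> nat \<Rightarrow> real)
    \<Rightarrow> nat \<Rightarrow> 'g \<times> 'd \<Rightarrow> real" where
  "stochastic_hamiltonian h hs N \<Delta>t \<Delta>W k x = h x + (\<Sum>i=1..N. hs i x * (\<Delta>W i k / \<Delta>t))"

text \<open>Only \<open>node c k\<close> for \<open>k \<le> M\<close> and the other entries for \<open>1 \<le> k \<le> M\<close> belong to a discrete curve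
  with \<open>M\<close> steps; the remaining values are irrelevant.\<close>

record ('g, 'd) discrete_curve =
  node :: "nat \<Rightarrow> 'g"
  midnode :: "nat \<Rightarrow> 'g"
  mom1 :: "nat \<Rightarrow> 'd"
  mom2 :: "nat \<Rightarrow> 'd"

definition in_retraction_range ::
  "('g, 'e::euclidean_space) lie_group_data \<Rightarrow> ('e \<Rightarrow> 'g) \<Rightarrow> 'e set \<Rightarrow> nat
    \<Rightarrow> ('g, 'e \<Rightarrow>\<^sub>L real) discrete_curve \<Rightarrow> bool" where
  "in_retraction_range G \<tau> U M c \<longleftrightarrow>
     (\<forall>k\<in>{1..M}. mult G (inverse_of G (midnode c k)) (node c k) \<in> \<tau> ` U \<and>
                  mult G (inverse_of G (node c (k - 1))) (midnode c k) \<in> \<tau> ` U)"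

definition discrete_action ::
  "('g, 'e::euclidean_space) lie_group_data \<Rightarrow> ('e \<Rightarrow> 'g) \<Rightarrow> 'e set
    \<Rightarrow> real \<Rightarrow> nat \<Rightarrow> (nat \<Rightarrow> 'g \<times> ('e \<Rightarrow>\<^sub>L real) \<Rightarrow> real)
    \<Rightarrow> ('g, 'e \<Rightarrow>\<^sub>L real) discrete_curve \<Rightarrow> real" where
  "discrete_action G \<tau> U \<Delta>t M H c =
     (\<Sum>k=1..M. \<Delta>t *
        (blinfun_apply (mom2 c k)
           (inv_into U \<tau> (mult G (inverse_of G (midnode c k)) (node c k)) /\<^sub>R \<Delta>t)
         + blinfun_apply (mom1 c k)
             (inv_into U \<tau> (mult G (inverse_of G (node c (k - 1))) (midnode c k)) /\<^sub>R \<Delta>t)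
         - H k (midnode c k, (mom1 c k + mom2 c k) /\<^sub>R 2)))"

text \<open>A variation of \<open>c\<close> with fixed endpoints; its velocity at \<open>0\<close> is the variation \<open>\<delta>c\<close>, which is
  an arbitrary tangent vector with \<open>\<delta>g\<^sub>0 = \<delta>g\<^sub>M = 0\<close>.\<close>

definition fixed_endpoint_variation ::
  "('g, 'e::euclidean_space) lie_group_data \<Rightarrow> nat \<Rightarrow> ('g, 'e \<Rightarrow>\<^sub>L real) discrete_curve
    \<Rightarrow> (real \<Rightarrow> ('g, 'e \<Rightarrow>\<^sub>L real) discrete_curve) \<Rightarrow> bool" where
  "fixed_endpoint_variation G M c \<gamma> \<longleftrightarrow>
     \<gamma> 0 = c \<and>
     (\<forall>t. node (\<gamma> t) 0 = node c 0 \<and> node (\<gamma> t) M = node c M) \<and>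
     (\<exists>r>0. (\<forall>k\<in>{0..M}. smooth_map_on model_atlas (atlas G) {-r<..<r} (\<lambda>t. node (\<gamma> t) k)) \<and>
            (\<forall>k\<in>{1..M}. smooth_map_on model_atlas (atlas G) {-r<..<r} (\<lambda>t. midnode (\<gamma> t) k) \<and>
               smooth_map_on model_atlas model_atlas {-r<..<r} (\<lambda>t. mom1 (\<gamma> t) k) \<and>
               smooth_map_on model_atlas model_atlas {-r<..<r} (\<lambda>t. mom2 (\<gamma> t) k)))"

definition critical_discrete_curve ::
  "('g, 'e::euclidean_space) lie_group_data \<Rightarrow> ('e \<Rightarrow> 'g) \<Rightarrow> 'e set
    \<Rightarrow> real \<Rightarrow> nat \<Rightarrow> (nat \<Rightarrow> 'g \<times> ('e \<Rightarrow>\<^sub>L real) \<Rightarrow> real)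
    \<Rightarrow> ('g, 'e \<Rightarrow>\<^sub>L real) discrete_curve \<Rightarrow> bool" where
  "critical_discrete_curve G \<tau> U \<Delta>t M H c \<longleftrightarrow>
     in_retraction_range G \<tau> U M c \<and>
     (\<forall>\<gamma>. fixed_endpoint_variation G M c \<gamma> \<longrightarrow>
        ((\<lambda>t. discrete_action G \<tau> U \<Delta>t M H (\<gamma> t)) has_real_derivative 0) (at 0))"

text \<open>\<open>cbar (a, b)\<close> is the critical discrete curve from \<open>a\<close> to \<open>b\<close>, for \<open>(a, b)\<close> in the open set
  \<open>E\<close> of pairs of endpoints where it exists and depends smoothly on them.\<close>

definition critical_curve_family ::
  "('g, 'e::euclidean_space) lie_group_data \<Rightarrow> ('e \<Rightarrow> 'g) \<Rightarrow> 'e set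
    \<Rightarrow> real \<Rightarrow> nat \<Rightarrow> (nat \<Rightarrow> 'g \<times> ('e \<Rightarrow>\<^sub>L real) \<Rightarrow> real)
    \<Rightarrow> ('g \<times> 'g) set \<Rightarrow> ('g \<times> 'g \<Rightarrow> ('g, 'e \<Rightarrow>\<^sub>L real) discrete_curve) \<Rightarrow> bool" where
  "critical_curve_family G \<tau> U \<Delta>t M H E cbar \<longleftrightarrow>
     (let A = atlas G; A2 = prod_atlas (atlas G) (atlas G) in
       openin (manifold_topology A2) E \<and>
       (\<forall>(a, b)\<in>E. node (cbar (a, b)) 0 = a \<and> node (cbar (a, b)) M = b \<and>
          critical_discrete_curve G \<tau> U \<Delta>t M H (cbar (a, b))) \<and>
       (\<forall>k\<in>{0..M}. smooth_map_on A2 A E (\<lambda>x. node (cbar x) k)) \<and>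
       (\<forall>k\<in>{1..M}. smooth_map_on A2 A E (\<lambda>x. midnode (cbar x) k) \<and>
          smooth_map_on A2 model_atlas E (\<lambda>x. mom1 (cbar x) k) \<and>
          smooth_map_on A2 model_atlas E (\<lambda>x. mom2 (cbar x) k)))"


section \<open>The discrete flow\<close>

definition generating_function ::
  "('g, 'e::euclidean_space) lie_group_data \<Rightarrow> ('e \<Rightarrow> 'g) \<Rightarrow> 'e set
    \<Rightarrow> real \<Rightarrow> nat \<Rightarrow> (nat \<Rightarrow> 'g \<times> ('e \<Rightarrow>\<^sub>L real) \<Rightarrow> real)
    \<Rightarrow> ('g \<times> 'g \<Rightarrow> ('g, 'e \<Rightarrow>\<^sub>L real) discrete_curve) \<Rightarrow> 'g \<Rightarrow> 'g \<Rightarrow> real" where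
  "generating_function G \<tau> U \<Delta>t M H cbar a b = discrete_action G \<tau> U \<Delta>t M H (cbar (a, b))"

definition initial_momentum ::
  "('g, 'e::euclidean_space) lie_group_data \<Rightarrow> ('g \<Rightarrow> 'g \<Rightarrow> real) \<Rightarrow> 'g \<Rightarrow> 'g \<Rightarrow> 'e \<Rightarrow>\<^sub>L real" where
  "initial_momentum G S a b = - differential (atlas G) (\<lambda>x. S x b) a"

definition final_momentum ::
  "('g, 'e::euclidean_space) lie_group_data \<Rightarrow> ('g \<Rightarrow> 'g \<Rightarrow> real) \<Rightarrow> 'g \<Rightarrow> 'g \<Rightarrow> 'e \<Rightarrow>\<^sub>L real" where
  "final_momentum G S a b = differential (atlas G) (\<lambda>y. S a y) b"

text \<open>On the open set \<open>D\<close> of the cotangent bundle, \<open>F\<close> is the smooth map determined by the equations: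
  \<open>F (g\<^sub>0, p\<^sub>0)\<close> is the only \<open>(g\<^sub>M, p\<^sub>M)\<close> joined to \<open>(g\<^sub>0, p\<^sub>0)\<close> by a curve of the family.\<close>

definition discrete_flow ::
  "('g, 'e::euclidean_space) lie_group_data \<Rightarrow> ('e \<Rightarrow> 'g) \<Rightarrow> 'e set
    \<Rightarrow> real \<Rightarrow> nat \<Rightarrow> (nat \<Rightarrow> 'g \<times> ('e \<Rightarrow>\<^sub>L real) \<Rightarrow> real)
    \<Rightarrow> ('g \<times> 'g) set \<Rightarrow> ('g \<times> 'g \<Rightarrow> ('g, 'e \<Rightarrow>\<^sub>L real) discrete_curve)
    \<Rightarrow> ('g \<times> ('e \<Rightarrow>\<^sub>L real)) set \<Rightarrow> ('g \<times> ('e \<Rightarrow>\<^sub>L real) \<Rightarrow> 'g \<times> ('e \<Rightarrow>\<^sub>L real)) \<Rightarrow> bool" where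
  "discrete_flow G \<tau> U \<Delta>t M H E cbar D F \<longleftrightarrow>
     (let TG = cotangent_atlas (atlas G); S = generating_function G \<tau> U \<Delta>t M H cbar in
       openin (manifold_topology TG) D \<and>
       smooth_map_on TG TG D F \<and>
       (\<forall>g0 p0 gM pM. (g0, p0) \<in> D \<longrightarrow>
          (F (g0, p0) = (gM, pM) \<longleftrightarrow>
             (g0, gM) \<in> E \<and> p0 = initial_momentum G S g0 gM \<and> pM = final_momentum G S g0 gM)))"

definition symplectic_on ::
  "('m, 'e::real_normed_vector) chart set \<Rightarrow> ('m \<times> ('e \<Rightarrow>\<^sub>L real)) set
    \<Rightarrow> ('m \<times> ('e \<Rightarrow>\<^sub>L real) \<Rightarrow> 'm \<times> ('e \<Rightarrow>\<^sub>L real)) \<Rightarrow> bool" where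
  "symplectic_on A D F \<longleftrightarrow>
     (\<forall>z\<in>D. pullback_form (cotangent_atlas A) (cotangent_atlas A) F (canonical_symplectic_form A) z
             = canonical_symplectic_form A z)"

end

theory Submission
  imports Defs
begin

text \<open>
  The flow is symplectic because the discrete action, evaluated on the critical curve with given
  endpoints, is a generating function of the first kind for it: with \<open>S a b\<close> this value,
  \<open>F (a, p) = (b, P)\<close> means \<open>p = - \<partial>S/\<partial>a\<close> and \<open>P = \<partial>S/\<partial>b\<close>, so along the graph of \<open>F\<close> the
  one-form \<open>P db - p da\<close> equals \<open>dS\<close>, and \<open>dP \<and> db - dp \<and> da = ddS = 0\<close>.

  In canonical coordinates this is a computation with one second derivative
  (\<open>generating_function_preserves_dq_wedge_dp\<close>). Write \<open>s\<close> for \<open>S\<close> in coordinates and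
  \<open>q v = (base point of v, base point of the image of v)\<close> for a point \<open>v\<close> of phase space. The
  momenta of \<open>v\<close> and of its image are the two halves of \<open>s' (q v)\<close>, up to the sign of the first.
  Differentiating these two identities at a point, the difference of the two values of \<open>dq \<and> dp\<close>
  on a pair of vectors turns out to be \<open>s'' \<eta> \<xi> - s'' \<xi> \<eta>\<close>, where \<open>\<xi>\<close> and \<open>\<eta>\<close> are the images of
  the two vectors under \<open>q'\<close>; it vanishes by the symmetry of second derivatives
  (\<open>second_derivative_symmetric\<close>).

  Two things remain. First, \<open>s\<close> must be twice differentiable: \<open>S\<close> is assembled from the smooth
  family of critical curves, the group operations, the inverse of the retraction map and the
  Hamiltonian, so this is the chain rule for maps between manifolds
  (\<open>generating_function_twice_differentiable\<close>). The computation differentiates \<open>s\<close> twice at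
  a point, and twice Frechet differentiability composes easily on all the normed spaces involved;
  the passage to it from the directional derivatives in the definition of smoothness uses that these
  spaces are finite dimensional. Second, the covectors in \<open>T\<^sup>*G\<close> are represented through a chosen
  chart at each point, and it must be checked that the momentum coordinate of the differential of a
  function is the derivative of its coordinate expression (\<open>differential_in_chart\<close>) and that the
  canonical form is \<open>dq \<and> dp\<close> at every point (\<open>canonical_symplectic_form_eq\<close>).
\<close>

section \<open>Twice differentiable maps between normed spaces\<close>

text \<open>The first derivative is a map into the normed space of bounded linear maps, so that the second
  derivative is a single Frechet derivative: the chain rule for it needs no coordinates, and the
  first derivative can be differentiated along maps of phase space.\<close>

definition twice_differentiable_at ::
  "('a::real_normed_vector \<Rightarrow> 'b::real_normed_vector) \<Rightarrow> 'a \<Rightarrow> bool" where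
  "twice_differentiable_at f x \<longleftrightarrow>
     (\<exists>f' :: 'a \<Rightarrow> 'a \<Rightarrow>\<^sub>L 'b. (\<forall>\<^sub>F y in nhds x. (f has_derivative blinfun_apply (f' y)) (at y)) \<and>
        f' differentiable (at x))"

lemma twice_differentiable_atI:
  fixes f' :: "'a::real_normed_vector \<Rightarrow> 'a \<Rightarrow>\<^sub>L 'b::real_normed_vector"
  assumes "\<forall>\<^sub>F y in nhds x. (f has_derivative blinfun_apply (f' y)) (at y)" "f' differentiable (at x)"
  shows "twice_differentiable_at f x"
  using assms unfolding twice_differentiable_at_def by blast

lemma has_derivative_cong_nhds:
  assumes "(f has_derivative D) (at x)" "\<forall>\<^sub>F y in nhds x. f y = g y"
  shows "(g has_derivative D) (at x)"
  using assms eventually_nhds_x_imp_x[OF assms(2)]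
  by (intro has_derivative_transform_eventually[OF assms(1)]) (auto simp: eventually_at_filter elim: eventually_mono)

lemma isCont_eventually_nhds:
  assumes "isCont f x" "\<forall>\<^sub>F z in nhds (f x). P z"
  shows "\<forall>\<^sub>F y in nhds x. P (f y)"
  using assms eventually_nhds_x_imp_x[OF assms(2)]
  by (simp add: isCont_def filterlim_iff eventually_nhds_conv_at)

lemma bounded_linear_differentiable:
  assumes "bounded_linear L" "f differentiable F"
  shows "(\<lambda>y. L (f y)) differentiable F"
  using assms bounded_linear.has_derivative unfolding differentiable_def by blast

lemma twice_differentiable_at_isCont:
  assumes "twice_differentiable_at f x" shows "isCont f x"
  using assms unfolding twice_differentiable_at_def
  by (metis eventually_nhds_x_imp_x has_derivative_continuous)

lemma twice_differentiable_at_cong: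
  assumes "twice_differentiable_at f x" "\<forall>\<^sub>F y in nhds x. f y = g y"
  shows "twice_differentiable_at g x"
proof -
  obtain f' where f': "\<forall>\<^sub>F y in nhds x. (f has_derivative blinfun_apply (f' y)) (at y)" "f' differentiable (at x)"
    using assms(1) unfolding twice_differentiable_at_def by blast
  have "\<forall>\<^sub>F y in nhds x. \<forall>\<^sub>F y in nhds y. f y = g y"
    using assms(2) by (simp add: eventually_eventually)
  with f'(1) have "\<forall>\<^sub>F y in nhds x. (g has_derivative blinfun_apply (f' y)) (at y)"
    by eventually_elim (rule has_derivative_cong_nhds)
  then show ?thesis using f'(2) by (rule twice_differentiable_atI)
qed

lemma twice_differentiable_at_compose:
  assumes f: "twice_differentiable_at f x" and g: "twice_differentiable_at g (f x)"
  shows "twice_differentiable_at (g \<circ> f) x"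
proof -
  obtain f' where f': "\<forall>\<^sub>F y in nhds x. (f has_derivative blinfun_apply (f' y)) (at y)" "f' differentiable (at x)"
    using f unfolding twice_differentiable_at_def by blast
  obtain g' where g': "\<forall>\<^sub>F y in nhds (f x). (g has_derivative blinfun_apply (g' y)) (at y)" "g' differentiable (at (f x))"
    using g unfolding twice_differentiable_at_def by blast
  have "\<forall>\<^sub>F y in nhds x. (g has_derivative blinfun_apply (g' (f y))) (at (f y))"
    using twice_differentiable_at_isCont[OF f] g'(1) by (rule isCont_eventually_nhds)
  with f'(1) have "\<forall>\<^sub>F y in nhds x. (g \<circ> f has_derivative blinfun_apply (g' (f y) o\<^sub>L f' y)) (at y)"
  proof eventually_elim
    case (elim y)
    have "blinfun_apply (g' (f y) o\<^sub>L f' y) = blinfun_apply (g' (f y)) \<circ> blinfun_apply (f' y)"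
      by auto
    with elim show ?case by (simp add: diff_chain_at)
  qed
  moreover have "(\<lambda>y. g' (f y) o\<^sub>L f' y) differentiable (at x)"
  proof -
    have "f differentiable (at x)"
      using eventually_nhds_x_imp_x[OF f'(1)] unfolding differentiable_def by blast
    then have "(\<lambda>y. g' (f y)) differentiable (at x)"
      using differentiable_chain_at[of f x g'] g'(2) by (simp add: comp_def)
    then show ?thesis
      using f'(2) bounded_bilinear.FDERIV[OF bounded_bilinear_blinfun_compose]
      unfolding differentiable_def by blast
  qed
  ultimately show ?thesis by (rule twice_differentiable_atI)
qed

lemma twice_differentiable_at_Pair:
  assumes f: "twice_differentiable_at f x" and g: "twice_differentiable_at g x"
  shows "twice_differentiable_at (\<lambda>x. (f x, g x)) x"
proof -
  obtain f' where f': "\<forall>\<^sub>F y in nhds x. (f has_derivative blinfun_apply (f' y)) (at y)" "f' differentiable (at x)"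
    using f unfolding twice_differentiable_at_def by blast
  obtain g' where g': "\<forall>\<^sub>F y in nhds x. (g has_derivative blinfun_apply (g' y)) (at y)" "g' differentiable (at x)"
    using g unfolding twice_differentiable_at_def by blast
  define inl inr where "inl = Blinfun (\<lambda>u::'b. (u, 0::'c))" and "inr = Blinfun (\<lambda>v::'c. (0::'b, v))"
  have [simp]: "blinfun_apply inl = (\<lambda>u. (u, 0))" "blinfun_apply inr = (\<lambda>v. (0, v))"
    unfolding inl_def inr_def
    by (intro bounded_linear_Blinfun_apply bounded_linear_intros | simp)+
  have "\<forall>\<^sub>F y in nhds x. ((\<lambda>x. (f x, g x)) has_derivative
      blinfun_apply ((inl o\<^sub>L f' y) + (inr o\<^sub>L g' y))) (at y)"
    using f'(1) g'(1)
  proof eventually_elim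
    case (elim y)
    then have "((\<lambda>x. (f x, g x)) has_derivative (\<lambda>h. (f' y h, g' y h))) (at y)"
      by (rule has_derivative_Pair)
    moreover have "blinfun_apply ((inl o\<^sub>L f' y) + (inr o\<^sub>L g' y)) = (\<lambda>h. (f' y h, g' y h))"
      by (auto simp: blinfun.add_left)
    ultimately show ?case by simp
  qed
  moreover have "(\<lambda>y. (inl o\<^sub>L f' y) + (inr o\<^sub>L g' y)) differentiable (at x)"
    using f'(2) g'(2)
    by (intro differentiable_add bounded_linear_differentiable[OF
          bounded_bilinear.bounded_linear_right[OF bounded_bilinear_blinfun_compose]])
  ultimately show ?thesis by (rule twice_differentiable_atI)
qed

text \<open>The first derivative of a bilinear map is itself linear in the point.\<close>

lemma (in bounded_bilinear) twice_differentiable_at: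
  "twice_differentiable_at (\<lambda>z. prod (fst z) (snd z)) x"
proof (rule twice_differentiable_atI)
  have "((\<lambda>z. prod (fst z) (snd z)) has_derivative
     blinfun_apply ((prod_right (fst y) o\<^sub>L snd_blinfun) + (prod_left (snd y) o\<^sub>L fst_blinfun))) (at y)" for y
  proof -
    have "blinfun_apply ((prod_right (fst y) o\<^sub>L snd_blinfun) + (prod_left (snd y) o\<^sub>L fst_blinfun)) =
      (\<lambda>h. prod (fst y) (snd h) + prod (fst h) (snd y))"
      by (auto simp: blinfun.add_left prod_right.rep_eq prod_left.rep_eq)
    then show ?thesis
      using FDERIV[OF has_derivative_fst[OF has_derivative_ident] has_derivative_snd[OF has_derivative_ident]]
      by simp
  qed
  then show "\<forall>\<^sub>F y in nhds x. ((\<lambda>z. prod (fst z) (snd z)) has_derivative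
     blinfun_apply ((prod_right (fst y) o\<^sub>L snd_blinfun) + (prod_left (snd y) o\<^sub>L fst_blinfun))) (at y)"
    by simp
  have "(\<lambda>y. prod_right (fst y) o\<^sub>L snd_blinfun) differentiable at x"
    "(\<lambda>y. prod_left (snd y) o\<^sub>L fst_blinfun) differentiable at x"
    by (auto intro!: bounded_linear_imp_differentiable bounded_linear_compose[OF bounded_bilinear.bounded_linear_left[OF bounded_bilinear_blinfun_compose]]
       bounded_linear_compose[OF bounded_linear_prod_right] bounded_linear_compose[OF bounded_linear_prod_left] bounded_linear_fst bounded_linear_snd)
  then show "(\<lambda>y. (prod_right (fst y) o\<^sub>L snd_blinfun) + (prod_left (snd y) o\<^sub>L fst_blinfun)) differentiable at x"
    by (rule differentiable_add)
qed

lemma bounded_linear_twice_differentiable_at: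
  assumes "bounded_linear f" shows "twice_differentiable_at f x"
  by (rule twice_differentiable_atI[where f' = "\<lambda>_. Blinfun f"])
     (simp_all add: bounded_linear_Blinfun_apply assms bounded_linear_imp_has_derivative)

section \<open>Symmetry of the second derivative\<close>

text \<open>The mean value theorem is applied to the increment of \<open>f\<close> in the direction \<open>v\<close>, as a function of
  the position on the segment from \<open>x\<close> to \<open>x + t u\<close>. It turns the second difference into a
  difference of first derivatives at two points whose displacement is \<open>t v\<close>, and differentiability
  of \<open>f'\<close> at the single point \<open>x\<close> evaluates that up to \<open>o(t\<^sup>2)\<close>.\<close>

lemma second_difference_tendsto:
  fixes f :: "'a::real_normed_vector \<Rightarrow> real" and f' :: "'a \<Rightarrow> 'a \<Rightarrow>\<^sub>L real"
  assumes ev: "\<forall>\<^sub>F y in nhds x. (f has_derivative blinfun_apply (f' y)) (at y)"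
    and f'': "(f' has_derivative f'') (at x)"
  shows "((\<lambda>t. (f (x + t *\<^sub>R u + t *\<^sub>R v) - f (x + t *\<^sub>R u) - f (x + t *\<^sub>R v) + f x) / t\<^sup>2)
           \<longlongrightarrow> f'' v u) (at_right 0)"
proof (rule tendstoI)
  fix e :: real assume "e > 0"
  \<comment> \<open>The two points compared below are at distance at most \<open>t (\<parallel>u\<parallel> + \<parallel>v\<parallel>)\<close> and \<open>t \<parallel>u\<parallel>\<close>
    from \<open>x\<close>, and \<open>K\<close> is the sum of these bounds divided by \<open>t\<close>.\<close>
  define K where "K = norm u + norm v + norm u"
  have K0: "K \<ge> 0" by (simp add: K_def)
  define \<epsilon> where "\<epsilon> = e / (2 * (K * norm u + 1))"
  have Kp: "K * norm u + 1 > 0" using K0 by (simp add: add_nonneg_pos)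
  then have e0: "\<epsilon> > 0" using \<open>e > 0\<close> by (simp add: \<epsilon>_def)
  obtain d1 where d1: "d1 > 0" "\<And>y. norm (y - x) < d1 \<Longrightarrow> norm (f' y - f' x - f'' (y - x)) \<le> \<epsilon> * norm (y - x)"
    using f'' e0 unfolding has_derivative_at_alt by blast
  obtain d2 where d2: "d2 > 0" "\<And>y. dist y x < d2 \<Longrightarrow> (f has_derivative blinfun_apply (f' y)) (at y)"
    using ev unfolding eventually_nhds_metric by blast
  define d where "d = min d1 d2 / (K + 1)"
  have d0: "d > 0" using d1(1) d2(1) K0 by (simp add: d_def)
  have lin: "linear f''" using f'' has_derivative_linear by blast
  have main: "dist ((f (x + t *\<^sub>R u + t *\<^sub>R v) - f (x + t *\<^sub>R u) - f (x + t *\<^sub>R v) + f x) / t\<^sup>2) (f'' v u) < e"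
    if t: "0 < t" "t < d" for t
  proof -
    have tK: "t * K < min d1 d2"
    proof -
      have "t * K \<le> t * (K + 1)" using t by simp
      also have "\<dots> < d * (K + 1)" using t K0 by (intro mult_strict_right_mono) auto
      also have "\<dots> = min d1 d2" using K0 by (simp add: d_def)
      finally show ?thesis .
    qed
    have n1: "norm (s *\<^sub>R (t *\<^sub>R u) + t *\<^sub>R v) \<le> t * (norm u + norm v)"
      and n2: "norm (s *\<^sub>R (t *\<^sub>R u)) \<le> t * norm u" if "0 \<le> s" "s \<le> 1" for s
    proof -
      have a: "s * (t * norm u) \<le> 1 * (t * norm u)" using that t by (intro mult_right_mono) auto
      then show "norm (s *\<^sub>R (t *\<^sub>R u)) \<le> t * norm u" using that t by simp
      have "norm (s *\<^sub>R (t *\<^sub>R u) + t *\<^sub>R v) \<le> norm (s *\<^sub>R (t *\<^sub>R u)) + norm (t *\<^sub>R v)" by (rule norm_triangle_ineq)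
      also have "\<dots> \<le> t * norm u + t * norm v" using a that t by simp
      finally show "norm (s *\<^sub>R (t *\<^sub>R u) + t *\<^sub>R v) \<le> t * (norm u + norm v)" by (simp add: algebra_simps)
    qed
    have b1: "t * (norm u + norm v) < min d1 d2" "t * norm u < min d1 d2"
    proof -
      have "t * (norm u + norm v) \<le> t * K" "t * norm u \<le> t * K"
        using t by (auto intro!: mult_left_mono simp: K_def)
      then show "t * (norm u + norm v) < min d1 d2" "t * norm u < min d1 d2"
        using tK by linarith+
    qed
    \<comment> \<open>The increment in the direction \<open>v\<close>, along the segment parametrised by \<open>s \<in> [0, 1]\<close>.\<close>
    define \<phi> where "\<phi> s = f (x + (s *\<^sub>R (t *\<^sub>R u) + t *\<^sub>R v)) - f (x + s *\<^sub>R (t *\<^sub>R u))" for s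
    have der: "(\<phi> has_derivative (\<lambda>h. f' (x + (s *\<^sub>R (t *\<^sub>R u) + t *\<^sub>R v)) (h *\<^sub>R (t *\<^sub>R u)) - f' (x + s *\<^sub>R (t *\<^sub>R u)) (h *\<^sub>R (t *\<^sub>R u)))) (at s within {0..1})"
      if "0 \<le> s" "s \<le> 1" for s
    proof -
      have i: "((\<lambda>s. x + (s *\<^sub>R (t *\<^sub>R u) + t *\<^sub>R v)) has_derivative (\<lambda>h. h *\<^sub>R (t *\<^sub>R u))) (at s within {0..1})"
        "((\<lambda>s. x + s *\<^sub>R (t *\<^sub>R u)) has_derivative (\<lambda>h. h *\<^sub>R (t *\<^sub>R u))) (at s within {0..1})"
        by (auto intro!: derivative_eq_intros)
      have o: "(f has_derivative f' (x + (s *\<^sub>R (t *\<^sub>R u) + t *\<^sub>R v))) (at (x + (s *\<^sub>R (t *\<^sub>R u) + t *\<^sub>R v)))"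
        "(f has_derivative f' (x + s *\<^sub>R (t *\<^sub>R u))) (at (x + s *\<^sub>R (t *\<^sub>R u)))"
        using n1[OF that] n2[OF that] b1 by (auto intro!: d2(2) simp: dist_norm)
      show ?thesis unfolding \<phi>_def
        by (intro has_derivative_diff has_derivative_compose[OF i(1) o(1)] has_derivative_compose[OF i(2) o(2)])
    qed
    obtain s where s: "0 < s" "s < 1"
      "\<phi> 1 - \<phi> 0 = f' (x + (s *\<^sub>R (t *\<^sub>R u) + t *\<^sub>R v)) (t *\<^sub>R u) - f' (x + s *\<^sub>R (t *\<^sub>R u)) (t *\<^sub>R u)"
      using mvt_simple[of 0 1 \<phi>, OF _ der] by auto
    \<comment> \<open>The displacements from \<open>x\<close> of the two points at which \<open>f'\<close> is evaluated; they differ by \<open>t v\<close>,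
      and \<open>r\<close> collects the two linearisation errors of \<open>f'\<close>.\<close>
    define w1 w2 where "w1 = s *\<^sub>R (t *\<^sub>R u) + t *\<^sub>R v" and "w2 = s *\<^sub>R (t *\<^sub>R u)"
    have w: "norm w1 \<le> t * (norm u + norm v)" "norm w2 \<le> t * norm u"
      using n1[of s] n2[of s] s by (auto simp: w1_def w2_def)
    define r where "r = (f' (x + w1) - f' x - f'' w1) - (f' (x + w2) - f' x - f'' w2)"
    have "norm r \<le> norm (f' (x + w1) - f' x - f'' w1) + norm (f' (x + w2) - f' x - f'' w2)"
      unfolding r_def by (rule norm_triangle_ineq4)
    also have "\<dots> \<le> \<epsilon> * norm w1 + \<epsilon> * norm w2"
      using d1(2)[of "x + w1"] d1(2)[of "x + w2"] w b1 by (auto intro: add_mono)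
    also have "\<dots> \<le> \<epsilon> * (t * (norm u + norm v)) + \<epsilon> * (t * norm u)"
      using w e0 by (intro add_mono mult_left_mono) auto
    also have "\<dots> = \<epsilon> * (t * K)" by (simp add: K_def algebra_simps)
    finally have r: "norm r \<le> \<epsilon> * (t * K)" .
    have "f'' w1 - f'' w2 = f'' (t *\<^sub>R v)"
      using linear_diff[OF lin, of w1 w2] by (simp add: w1_def w2_def)
    moreover have "f'' (t *\<^sub>R v) = t *\<^sub>R f'' v" by (rule linear_scale[OF lin])
    moreover have "f' (x + w1) - f' (x + w2) = (f'' w1 - f'' w2) + r" by (simp add: r_def)
    ultimately have "f' (x + w1) - f' (x + w2) = t *\<^sub>R f'' v + r" by simp
    moreover have "\<phi> 1 - \<phi> 0 = (f' (x + w1) - f' (x + w2)) (t *\<^sub>R u)"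
      using s(3) by (simp only: w1_def w2_def blinfun.diff_left)
    ultimately have "\<phi> 1 - \<phi> 0 = (t *\<^sub>R f'' v + r) (t *\<^sub>R u)" by simp
    also have "\<dots> = t\<^sup>2 * f'' v u + t * r u"
      by (simp add: blinfun.add_left blinfun.scaleR_left blinfun.scaleR_right power2_eq_square algebra_simps)
    also have "\<phi> 1 - \<phi> 0 = f (x + t *\<^sub>R u + t *\<^sub>R v) - f (x + t *\<^sub>R u) - f (x + t *\<^sub>R v) + f x"
      by (simp add: \<phi>_def add.assoc)
    finally have "(f (x + t *\<^sub>R u + t *\<^sub>R v) - f (x + t *\<^sub>R u) - f (x + t *\<^sub>R v) + f x) / t\<^sup>2 - f'' v u = r u / t"
      using t by (simp add: field_simps power2_eq_square)
    moreover have "\<bar>r u / t\<bar> < e"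
    proof -
      have "norm (r u) \<le> norm r * norm u" by (rule norm_blinfun)
      also have "\<dots> \<le> \<epsilon> * (t * K) * norm u" by (intro mult_right_mono r) auto
      finally have "\<bar>r u / t\<bar> \<le> \<epsilon> * (K * norm u)" using t by (simp add: field_simps)
      also have "\<dots> < \<epsilon> * (2 * (K * norm u + 1))" using e0 K0 by (intro mult_strict_left_mono) (auto intro: add_nonneg_pos)
      also have "\<dots> = e" using Kp by (simp add: \<epsilon>_def)
      finally show ?thesis .
    qed
    ultimately show ?thesis by (simp add: dist_real_def)
  qed
  show "\<forall>\<^sub>F t in at_right 0. dist ((f (x + t *\<^sub>R u + t *\<^sub>R v) - f (x + t *\<^sub>R u) - f (x + t *\<^sub>R v) + f x) / t\<^sup>2) (f'' v u) < e"
    unfolding eventually_at_right_field using d0 main by blast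
qed

text \<open>The second difference is symmetric in the two directions, hence so is its limit.\<close>

lemma second_derivative_symmetric:
  fixes f :: "'a::real_normed_vector \<Rightarrow> real" and f' :: "'a \<Rightarrow> 'a \<Rightarrow>\<^sub>L real"
  assumes "\<forall>\<^sub>F y in nhds x. (f has_derivative blinfun_apply (f' y)) (at y)" and "(f' has_derivative f'') (at x)"
  shows "f'' u v = f'' v u"
proof -
  note uv = second_difference_tendsto[OF assms, of u v] and vu = second_difference_tendsto[OF assms, of v u]
  have "(\<lambda>t. (f (x + t *\<^sub>R u + t *\<^sub>R v) - f (x + t *\<^sub>R u) - f (x + t *\<^sub>R v) + f x) / t\<^sup>2) =
    (\<lambda>t. (f (x + t *\<^sub>R v + t *\<^sub>R u) - f (x + t *\<^sub>R v) - f (x + t *\<^sub>R u) + f x) / t\<^sup>2)"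
    by (rule ext) (simp add: add.assoc add.commute[of "_ *\<^sub>R u"] diff_right_commute)
  with uv vu show ?thesis
    using tendsto_unique[OF trivial_limit_at_right_real uv, of "blinfun_apply (f'' u) v"] by simp
qed

section \<open>From coordinatewise to Frechet differentiability\<close>

text \<open>Finite dimensionality in the form in which it is used, for spaces such as the dual
  \<open>'e \<Rightarrow>\<^sub>L real\<close> that carry no inner product: finitely many vectors and continuous coordinate
  functionals reproduce every vector.\<close>

definition has_finite_frame :: "'a::real_normed_vector itself \<Rightarrow> bool" where
  "has_finite_frame _ \<longleftrightarrow>
     (\<exists>(B :: 'a set) (coord :: 'a \<Rightarrow> 'a \<Rightarrow>\<^sub>L real). finite B \<and> (\<forall>x. (\<Sum>b\<in>B. coord b x *\<^sub>R b) = x))"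

lemma has_finite_frameI:
  fixes b :: "'i \<Rightarrow> 'a::real_normed_vector"
  assumes "finite I" "\<And>x. (\<Sum>i\<in>I. coord i x *\<^sub>R b i) = x" "\<And>i. bounded_linear (coord i)"
  shows "has_finite_frame TYPE('a)"
proof -
  \<comment> \<open>Different indices may carry the same vector, whose coordinates are then added.\<close>
  define c where "c y = (\<Sum>i | i \<in> I \<and> b i = y. Blinfun (coord i))" for y
  have "(\<Sum>y\<in>b ` I. c y x *\<^sub>R y) = x" for x
  proof -
    have "c y x *\<^sub>R y = (\<Sum>i | i \<in> I \<and> b i = y. coord i x *\<^sub>R b i)" for y
      by (simp add: c_def blinfun.sum_left scaleR_sum_left bounded_linear_Blinfun_apply assms(3))
    then show ?thesis
      using sum.group[of I "b ` I" b "\<lambda>i. coord i x *\<^sub>R b i"] assms(1,2) by simp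
  qed
  moreover have "finite (b ` I)" using assms(1) by simp
  ultimately show ?thesis unfolding has_finite_frame_def by blast
qed

lemma has_finite_frame_euclidean: "has_finite_frame TYPE('a::euclidean_space)"
  by (rule has_finite_frameI[where I = Basis and b = "\<lambda>i. i" and coord = "\<lambda>i x. x \<bullet> i"])
     (simp_all add: euclidean_representation bounded_linear_inner_left)

lemma has_finite_frame_dual: "has_finite_frame TYPE('a::euclidean_space \<Rightarrow>\<^sub>L real)"
proof (rule has_finite_frameI[where I = Basis and b = blinfun_inner_left and coord = "\<lambda>i \<alpha>. blinfun_apply \<alpha> i"])
  fix \<alpha> :: "'a \<Rightarrow>\<^sub>L real"
  show "(\<Sum>i\<in>Basis. blinfun_apply \<alpha> i *\<^sub>R blinfun_inner_left i) = \<alpha>"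
  proof (rule blinfun_eqI)
    fix v
    have "blinfun_apply \<alpha> v = blinfun_apply \<alpha> (\<Sum>i\<in>Basis. (v \<bullet> i) *\<^sub>R i)" by (simp add: euclidean_representation)
    also have "\<dots> = blinfun_apply (\<Sum>i\<in>Basis. blinfun_apply \<alpha> i *\<^sub>R blinfun_inner_left i) v"
      by (simp add: blinfun.sum_right blinfun.sum_left blinfun.scaleR_left blinfun.scaleR_right mult.commute)
    finally show "blinfun_apply (\<Sum>i\<in>Basis. blinfun_apply \<alpha> i *\<^sub>R blinfun_inner_left i) v = blinfun_apply \<alpha> v" ..
  qed
qed (auto intro: bounded_linear_intros)

lemma has_finite_frame_prod:
  assumes "has_finite_frame TYPE('a::real_normed_vector)" "has_finite_frame TYPE('b::real_normed_vector)"
  shows "has_finite_frame TYPE('a \<times> 'b)"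
proof -
  obtain B :: "'a set" and c where B: "finite B" "\<And>x. (\<Sum>b\<in>B. blinfun_apply (c b) x *\<^sub>R b) = x"
    using assms(1) unfolding has_finite_frame_def by blast
  obtain B' :: "'b set" and c' where B': "finite B'" "\<And>x. (\<Sum>b\<in>B'. blinfun_apply (c' b) x *\<^sub>R b) = x"
    using assms(2) unfolding has_finite_frame_def by blast
  show ?thesis
  proof (rule has_finite_frameI[where I = "B <+> B'" and b = "case_sum (\<lambda>b. (b, 0)) (\<lambda>b. (0, b))"
        and coord = "\<lambda>i z. case i of Inl b \<Rightarrow> blinfun_apply (c b) (fst z) | Inr b \<Rightarrow> blinfun_apply (c' b) (snd z)"])
    show "finite (B <+> B')" using B B' by simp
    fix z :: "'a \<times> 'b"
    have 1: "(\<Sum>x\<in>B. (blinfun_apply (c x) (fst z) *\<^sub>R x, 0)) = (fst z, 0::'b)"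
      using B by (subst sum_prod) auto
    have 2: "(\<Sum>x\<in>B'. (0::'a, blinfun_apply (c' x) (snd z) *\<^sub>R x)) = (0, snd z)"
      using B' by (subst sum_prod) auto
    show "(\<Sum>i\<in>B <+> B'. (case i of Inl b \<Rightarrow> blinfun_apply (c b) (fst z) | Inr b \<Rightarrow> blinfun_apply (c' b) (snd z)) *\<^sub>R
        case_sum (\<lambda>b. (b, 0)) (\<lambda>b. (0, b)) i) = z"
      using B(1) B'(1) by (simp add: sum.Plus 1 2)
  next
    fix i :: "'a + 'b"
    show "bounded_linear (\<lambda>z. case i of Inl b \<Rightarrow> blinfun_apply (c b) (fst z) | Inr b \<Rightarrow> blinfun_apply (c' b) (snd z))"
      by (cases i) (auto intro!: bounded_linear_intros)
  qed
qed

text \<open>Smoothness speaks of each directional derivative \<open>x \<mapsto> f' x v\<close> separately. In finite dimension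
  \<open>f' x\<close> is the sum of the rank-one maps \<open>coord b \<otimes> f' x b\<close>, and each summand depends on \<open>x\<close>
  through the differentiable vector \<open>f' x b\<close> alone.\<close>

lemma Ck_on_imp_twice_differentiable_at:
  fixes f :: "'a::real_normed_vector \<Rightarrow> 'b::real_normed_vector"
  assumes "has_finite_frame TYPE('a)" "open S" "Ck_on (Suc (Suc k)) S f" "x \<in> S"
  shows "twice_differentiable_at f x"
proof -
  obtain B :: "'a set" and c where B: "finite B" "\<And>x. (\<Sum>b\<in>B. blinfun_apply (c b) x *\<^sub>R b) = x"
    using assms(1) unfolding has_finite_frame_def by blast
  define f' where "f' y = (\<Sum>b\<in>B. blinfun_scaleR_left (frechet_derivative f (at y) b) o\<^sub>L c b)" for y
  have "(f has_derivative blinfun_apply (f' y)) (at y)" if "y \<in> S" for y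
  proof -
    have d: "(f has_derivative frechet_derivative f (at y)) (at y)"
      using assms(3) that frechet_derivative_works by auto
    have "frechet_derivative f (at y) v = f' y v" for v
    proof -
      have "frechet_derivative f (at y) v = frechet_derivative f (at y) (\<Sum>b\<in>B. blinfun_apply (c b) v *\<^sub>R b)"
        by (simp add: B)
      also have "\<dots> = f' y v"
        using has_derivative_linear[OF d]
        by (simp add: f'_def blinfun.sum_left linear_sum linear_scale)
      finally show ?thesis .
    qed
    then have "frechet_derivative f (at y) = blinfun_apply (f' y)" by blast
    with d show ?thesis by simp
  qed
  then have "\<forall>\<^sub>F y in nhds x. (f has_derivative blinfun_apply (f' y)) (at y)"
    using assms(2,4) by (auto simp: eventually_nhds)
  moreover have "f' differentiable (at x)"
  proof -
    have "(\<lambda>y. frechet_derivative f (at y) b) differentiable (at x)" for b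
      using assms(3,4) by auto
    then have "(\<lambda>y. blinfun_scaleR_left (frechet_derivative f (at y) b) o\<^sub>L c b) differentiable (at x)" for b
      by (rule bounded_linear_differentiable[OF bounded_linear_compose[OF
          bounded_bilinear.bounded_linear_left[OF bounded_bilinear_blinfun_compose] bounded_linear_blinfun_scaleR_left]])
    then show ?thesis unfolding f'_def using B(1) by (intro differentiable_sum) auto
  qed
  ultimately show ?thesis by (rule twice_differentiable_atI)
qed

section \<open>Twice differentiable maps between manifolds\<close>

text \<open>The part of the definition of a manifold that composing coordinate expressions needs; it passes
  directly to product atlases and to the cotangent bundle.\<close>

definition atlas_charts :: "('m, 'e) chart set \<Rightarrow> bool" where
  "atlas_charts A \<longleftrightarrow> (\<Union>c\<in>A. fst c) = UNIV \<and> (\<forall>c\<in>A. inj_on (snd c) (fst c))"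

lemma chart_inv_chart:
  assumes "atlas_charts A" "c \<in> A" "x \<in> fst c"
  shows "chart_inv c (snd c x) = x"
  using assms unfolding atlas_charts_def chart_inv_def by (auto intro: inv_into_f_f)

lemma atlas_charts_cover:
  assumes "atlas_charts A" obtains c where "c \<in> A" "x \<in> fst c"
  using assms unfolding atlas_charts_def by blast

lemma atlas_charts_manifold: "smooth_manifold A \<Longrightarrow> atlas_charts A"
  unfolding smooth_manifold_def atlas_charts_def by simp

lemma atlas_charts_model: "atlas_charts model_atlas"
  by (simp add: atlas_charts_def model_atlas_def)

lemma prod_atlasE:
  assumes "c \<in> prod_atlas A B"
  obtains d e where "d \<in> A" "e \<in> B" "c = (fst d \<times> fst e, map_prod (snd d) (snd e))"
proof -
  obtain p where "p \<in> A \<times> B" "c = (case p of (c, d) \<Rightarrow> (fst c \<times> fst d, map_prod (snd c) (snd d)))"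
    using assms unfolding prod_atlas_def by blast
  then show thesis using that[of "fst p" "snd p"] by (simp add: mem_Times_iff split_beta)
qed

lemma atlas_charts_prod:
  assumes "atlas_charts A" "atlas_charts B" shows "atlas_charts (prod_atlas A B)"
  unfolding atlas_charts_def
proof (intro conjI ballI)
  show "(\<Union>c\<in>prod_atlas A B. fst c) = UNIV"
  proof (intro set_eqI iffI UNIV_I)
    fix z :: "'a \<times> 'c"
    obtain c where "c \<in> A" "fst z \<in> fst c" using atlas_charts_cover[OF assms(1)] .
    moreover obtain d where "d \<in> B" "snd z \<in> fst d" using atlas_charts_cover[OF assms(2)] .
    ultimately show "z \<in> (\<Union>c\<in>prod_atlas A B. fst c)"
      unfolding prod_atlas_def by (cases z) force
  qed
  show "inj_on (snd c) (fst c)" if c: "c \<in> prod_atlas A B" for c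
  proof -
    obtain c1 c2 where "c1 \<in> A" "c2 \<in> B" "c = (fst c1 \<times> fst c2, map_prod (snd c1) (snd c2))"
      using c by (rule prod_atlasE)
    with assms show ?thesis unfolding atlas_charts_def by (simp add: map_prod_inj_on)
  qed
qed

text \<open>The first clause is continuity at \<open>x\<close> as seen from the chart \<open>d\<close>: nearby points must stay in the
  domain of \<open>d\<close> for the coordinate expression to represent \<open>f\<close> there. All charts around \<open>x\<close> and
  \<open>f x\<close> are admitted, so a composition can pass through any chart at the intermediate point.\<close>

definition twice_differentiable_map_at ::
  "('m, 'e::real_normed_vector) chart set \<Rightarrow> ('n, 'f::real_normed_vector) chart set
    \<Rightarrow> ('m \<Rightarrow> 'n) \<Rightarrow> 'm \<Rightarrow> bool" where
  "twice_differentiable_map_at A B f x \<longleftrightarrow>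
     (\<forall>c\<in>A. \<forall>d\<in>B. x \<in> fst c \<longrightarrow> f x \<in> fst d \<longrightarrow>
        (\<forall>\<^sub>F y in nhds (snd c x). f (chart_inv c y) \<in> fst d) \<and>
        twice_differentiable_at (snd d \<circ> f \<circ> chart_inv c) (snd c x))"

lemma smooth_map_on_coordinates:
  fixes A :: "('m, 'e::real_normed_vector) chart set"
  assumes f: "smooth_map_on A B S f" and A: "atlas_charts A"
    and c: "c \<in> A" "d \<in> B" "x \<in> S" "x \<in> fst c" "f x \<in> fst d"
  obtains X where "open X" "snd c x \<in> X" "Ck_on k X (snd d \<circ> f \<circ> chart_inv c)"
    "\<forall>y\<in>X. y \<in> snd c ` fst c \<and> chart_inv c y \<in> S \<and> f (chart_inv c y) \<in> fst d"
proof
  let ?X = "snd c ` (S \<inter> fst c \<inter> f -` fst d)"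
  show "open ?X" "Ck_on k ?X (snd d \<circ> f \<circ> chart_inv c)"
    using f c unfolding smooth_map_on_def smooth_on_def Let_def by auto
  show "snd c x \<in> ?X" using c by auto
  show "\<forall>y\<in>?X. y \<in> snd c ` fst c \<and> chart_inv c y \<in> S \<and> f (chart_inv c y) \<in> fst d"
    using chart_inv_chart[OF A c(1)] by auto
qed

lemma smooth_map_on_twice_differentiable_at:
  fixes A :: "('m, 'e::real_normed_vector) chart set"
  assumes "has_finite_frame TYPE('e)" "atlas_charts A" "smooth_map_on A B S f" "x \<in> S"
  shows "twice_differentiable_map_at A B f x"
  unfolding twice_differentiable_map_at_def
proof (intro ballI impI)
  fix c d assume c: "c \<in> A" "d \<in> B" "x \<in> fst c" "f x \<in> fst d"
  obtain X where X: "open X" "snd c x \<in> X" "Ck_on (Suc (Suc 0)) X (snd d \<circ> f \<circ> chart_inv c)"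
    "\<forall>y\<in>X. y \<in> snd c ` fst c \<and> chart_inv c y \<in> S \<and> f (chart_inv c y) \<in> fst d"
    using smooth_map_on_coordinates[OF assms(3,2) c(1,2) assms(4) c(3,4), where k = "Suc (Suc 0)"] .
  show "(\<forall>\<^sub>F y in nhds (snd c x). f (chart_inv c y) \<in> fst d) \<and>
        twice_differentiable_at (snd d \<circ> f \<circ> chart_inv c) (snd c x)"
    using X Ck_on_imp_twice_differentiable_at[OF assms(1) X(1,3,2)] by (auto simp: eventually_nhds)
qed

lemma twice_differentiable_map_at_compose:
  assumes B: "atlas_charts B"
    and f: "twice_differentiable_map_at A B f x" and g: "twice_differentiable_map_at B C g (f x)"
    and A: "atlas_charts A"
  shows "twice_differentiable_map_at A C (\<lambda>x. g (f x)) x"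
  unfolding twice_differentiable_map_at_def
proof (intro ballI impI)
  fix c e assume c: "c \<in> A" "x \<in> fst c" and e: "e \<in> C" "g (f x) \<in> fst e"
  obtain d where d: "d \<in> B" "f x \<in> fst d" using atlas_charts_cover[OF B] .
  let ?f = "snd d \<circ> f \<circ> chart_inv c" and ?g = "snd e \<circ> g \<circ> chart_inv d"
  have [simp]: "?f (snd c x) = snd d (f x)" using chart_inv_chart[OF A c] by simp
  have F: "\<forall>\<^sub>F y in nhds (snd c x). f (chart_inv c y) \<in> fst d" "twice_differentiable_at ?f (snd c x)"
    using f c d unfolding twice_differentiable_map_at_def by blast+
  have G: "\<forall>\<^sub>F y in nhds (snd d (f x)). g (chart_inv d y) \<in> fst e" "twice_differentiable_at ?g (snd d (f x))"
    using g e d unfolding twice_differentiable_map_at_def by blast+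
  have "\<forall>\<^sub>F y in nhds (snd c x). g (chart_inv d (?f y)) \<in> fst e"
    using G(1) by (intro isCont_eventually_nhds[OF twice_differentiable_at_isCont[OF F(2)]]) (simp add: chart_inv_chart[OF A c])
  with F(1) have "\<forall>\<^sub>F y in nhds (snd c x). g (f (chart_inv c y)) \<in> fst e"
    by eventually_elim (simp add: chart_inv_chart[OF B d(1)])
  moreover have "twice_differentiable_at (snd e \<circ> (\<lambda>x. g (f x)) \<circ> chart_inv c) (snd c x)"
  proof (rule twice_differentiable_at_cong)
    show "twice_differentiable_at (?g \<circ> ?f) (snd c x)"
      using F(2) G(2) by (intro twice_differentiable_at_compose) (simp_all add: chart_inv_chart[OF A c])
    show "\<forall>\<^sub>F y in nhds (snd c x). (?g \<circ> ?f) y = (snd e \<circ> (\<lambda>x. g (f x)) \<circ> chart_inv c) y"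
      using F(1) by eventually_elim (simp add: chart_inv_chart[OF B d(1)])
  qed
  ultimately show "(\<forall>\<^sub>F y in nhds (snd c x). g (f (chart_inv c y)) \<in> fst e) \<and>
    twice_differentiable_at (snd e \<circ> (\<lambda>x. g (f x)) \<circ> chart_inv c) (snd c x)" by simp
qed

lemma twice_differentiable_map_at_Pair:
  assumes f: "twice_differentiable_map_at A B f x" and g: "twice_differentiable_map_at A C g x"
  shows "twice_differentiable_map_at A (prod_atlas B C) (\<lambda>x. (f x, g x)) x"
  unfolding twice_differentiable_map_at_def
proof (intro ballI impI)
  fix c d assume c: "c \<in> A" "x \<in> fst c" and d: "d \<in> prod_atlas B C" "(f x, g x) \<in> fst d"
  obtain d1 d2 where d12: "d1 \<in> B" "d2 \<in> C" "d = (fst d1 \<times> fst d2, map_prod (snd d1) (snd d2))"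
    using d(1) by (rule prod_atlasE)
  have F: "\<forall>\<^sub>F y in nhds (snd c x). f (chart_inv c y) \<in> fst d1" "twice_differentiable_at (snd d1 \<circ> f \<circ> chart_inv c) (snd c x)"
    using f c d d12 unfolding twice_differentiable_map_at_def by auto
  have G: "\<forall>\<^sub>F y in nhds (snd c x). g (chart_inv c y) \<in> fst d2" "twice_differentiable_at (snd d2 \<circ> g \<circ> chart_inv c) (snd c x)"
    using g c d d12 unfolding twice_differentiable_map_at_def by auto
  have "twice_differentiable_at (snd d \<circ> (\<lambda>x. (f x, g x)) \<circ> chart_inv c) (snd c x)"
    using twice_differentiable_at_Pair[OF F(2) G(2)] by (simp add: d12 comp_def)
  then show "(\<forall>\<^sub>F y in nhds (snd c x). (f (chart_inv c y), g (chart_inv c y)) \<in> fst d) \<and>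
     twice_differentiable_at (snd d \<circ> (\<lambda>x. (f x, g x)) \<circ> chart_inv c) (snd c x)"
    using eventually_conj[OF F(1) G(1)] by (simp add: d12)
qed

lemma twice_differentiable_map_at_model:
  "twice_differentiable_map_at A model_atlas f x \<longleftrightarrow>
     (\<forall>c\<in>A. x \<in> fst c \<longrightarrow> twice_differentiable_at (f \<circ> chart_inv c) (snd c x))"
  unfolding twice_differentiable_map_at_def model_atlas_def by simp

lemma twice_differentiable_map_at_model_compose:
  assumes "atlas_charts A" "twice_differentiable_map_at A model_atlas f x" "twice_differentiable_at k (f x)"
  shows "twice_differentiable_map_at A model_atlas (\<lambda>x. k (f x)) x"
  unfolding twice_differentiable_map_at_model
proof (intro ballI impI)
  fix c assume c: "c \<in> A" "x \<in> fst c"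
  have "twice_differentiable_at (k \<circ> (f \<circ> chart_inv c)) (snd c x)"
  proof (rule twice_differentiable_at_compose)
    show "twice_differentiable_at (f \<circ> chart_inv c) (snd c x)"
      using assms(2) c unfolding twice_differentiable_map_at_model by blast
    show "twice_differentiable_at k ((f \<circ> chart_inv c) (snd c x))"
      using assms(3) chart_inv_chart[OF assms(1) c] by simp
  qed
  then show "twice_differentiable_at ((\<lambda>x. k (f x)) \<circ> chart_inv c) (snd c x)"
    by (simp add: comp_def)
qed

lemma twice_differentiable_map_at_model_Pair:
  assumes "twice_differentiable_map_at A model_atlas f x" "twice_differentiable_map_at A model_atlas g x"
  shows "twice_differentiable_map_at A model_atlas (\<lambda>x. (f x, g x)) x"
  unfolding twice_differentiable_map_at_model
proof (intro ballI impI)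
  fix c assume c: "c \<in> A" "x \<in> fst c"
  have "twice_differentiable_at (f \<circ> chart_inv c) (snd c x)" "twice_differentiable_at (g \<circ> chart_inv c) (snd c x)"
    using assms c unfolding twice_differentiable_map_at_model by blast+
  from twice_differentiable_at_Pair[OF this]
  show "twice_differentiable_at ((\<lambda>x. (f x, g x)) \<circ> chart_inv c) (snd c x)"
    by (simp add: comp_def)
qed

lemma (in bounded_bilinear) twice_differentiable_map_at:
  assumes "atlas_charts A" "twice_differentiable_map_at A model_atlas f x" "twice_differentiable_map_at A model_atlas g x"
  shows "twice_differentiable_map_at A model_atlas (\<lambda>x. prod (f x) (g x)) x"
  using twice_differentiable_map_at_model_compose[OF assms(1)
      twice_differentiable_map_at_model_Pair[OF assms(2,3)] twice_differentiable_at] by simp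

lemma bounded_linear_twice_differentiable_map_at:
  assumes "bounded_linear L" "atlas_charts A" "twice_differentiable_map_at A model_atlas f x"
  shows "twice_differentiable_map_at A model_atlas (\<lambda>x. L (f x)) x"
  by (rule twice_differentiable_map_at_model_compose[OF assms(2,3)
        bounded_linear_twice_differentiable_at[OF assms(1)]])

lemma twice_differentiable_map_at_add:
  assumes "atlas_charts A" "twice_differentiable_map_at A model_atlas f x" "twice_differentiable_map_at A model_atlas g x"
  shows "twice_differentiable_map_at A model_atlas (\<lambda>x. f x + g x) x"
  using bounded_linear_twice_differentiable_map_at[OF
      bounded_linear_add[OF bounded_linear_fst bounded_linear_snd] assms(1)
      twice_differentiable_map_at_model_Pair[OF assms(2,3)]] by simp

lemma twice_differentiable_map_at_diff:
  assumes "atlas_charts A" "twice_differentiable_map_at A model_atlas f x" "twice_differentiable_map_at A model_atlas g x"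
  shows "twice_differentiable_map_at A model_atlas (\<lambda>x. f x - g x) x"
  using bounded_linear_twice_differentiable_map_at[OF
      bounded_linear_sub[OF bounded_linear_fst bounded_linear_snd] assms(1)
      twice_differentiable_map_at_model_Pair[OF assms(2,3)]] by simp

lemma twice_differentiable_map_at_sum:
  fixes f :: "'i \<Rightarrow> 'm \<Rightarrow> 'b::real_normed_vector"
  assumes "atlas_charts A" "\<And>i. i \<in> I \<Longrightarrow> twice_differentiable_map_at A model_atlas (f i) x"
  shows "twice_differentiable_map_at A model_atlas (\<lambda>x. \<Sum>i\<in>I. f i x) x"
proof -
  have "twice_differentiable_map_at A model_atlas (\<lambda>x. 0 :: 'b) x"
    unfolding twice_differentiable_map_at_model comp_def
    by (intro ballI impI bounded_linear_twice_differentiable_at bounded_linear_zero)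
  then show ?thesis using assms(2)
  proof (induction I rule: infinite_finite_induct)
    case (insert i I)
    then have "twice_differentiable_map_at A model_atlas (\<lambda>x. f i x + (\<Sum>i\<in>I. f i x)) x"
      by (intro twice_differentiable_map_at_add[OF assms(1)]) simp_all
    then show ?case using insert.hyps by simp
  qed simp_all
qed

section \<open>Canonical coordinates on the cotangent bundle\<close>

lemma blinfun_compose_assoc: "(f o\<^sub>L g) o\<^sub>L h = f o\<^sub>L (g o\<^sub>L h)"
  by (rule blinfun_eqI) simp

lemma blinfun_compose_id [simp]: "f o\<^sub>L id_blinfun = f"
  by (rule blinfun_eqI) simp

lemma chart_at_in_atlas:
  assumes "(\<Union>c\<in>A. fst c) = UNIV"
  shows "chart_at A x \<in> A" "x \<in> fst (chart_at A x)"
proof -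
  have "\<exists>c. c \<in> A \<and> x \<in> fst c" using assms by blast
  then have "chart_at A x \<in> A \<and> x \<in> fst (chart_at A x)"
    unfolding chart_at_def by (rule someI_ex)
  then show "chart_at A x \<in> A" "x \<in> fst (chart_at A x)" by auto
qed

lemma chart_at_model [simp]: "chart_at model_atlas x = (UNIV, id)"
  using chart_at_in_atlas[of model_atlas] by (simp add: model_atlas_def)

lemma chart_inv_model [simp]: "chart_inv (UNIV, id) = id"
  by (simp add: chart_inv_def)

lemma chart_inv_prod:
  assumes A: "atlas_charts A" "c \<in> A" "x \<in> snd c ` fst c"
    and B: "atlas_charts B" "d \<in> B" "y \<in> snd d ` fst d"
  shows "chart_inv (fst c \<times> fst d, map_prod (snd c) (snd d)) (x, y) = (chart_inv c x, chart_inv d y)"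
proof -
  obtain m n where m: "m \<in> fst c" "x = snd c m" and n: "n \<in> fst d" "y = snd d n"
    using A(3) B(3) by auto
  let ?cd = "(fst c \<times> fst d, map_prod (snd c) (snd d))"
  have "?cd \<in> prod_atlas A B" using A(2) B(2) unfolding prod_atlas_def by force
  then have "chart_inv ?cd (snd ?cd (m, n)) = (m, n)"
    using m n by (intro chart_inv_chart[OF atlas_charts_prod[OF A(1) B(1)]]) auto
  then show ?thesis
    by (simp add: m(2) n(2) chart_inv_chart[OF A(1,2) m(1)] chart_inv_chart[OF B(1,2) n(1)])
qed

lemma chart_domain_nhds:
  assumes "smooth_manifold A" "c \<in> A" "g \<in> fst c"
  shows "\<forall>\<^sub>F y in nhds (snd c g). y \<in> snd c ` fst c"
  using assms unfolding smooth_manifold_def eventually_nhds by blast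

lemma chart_transition_differentiable:
  assumes "smooth_manifold A" "c \<in> A" "d \<in> A" "g \<in> fst c" "g \<in> fst d"
  obtains T where "(snd d \<circ> chart_inv c has_derivative blinfun_apply T) (at (snd c g))"
proof -
  have "smooth_on (snd c ` (fst c \<inter> fst d)) (snd d \<circ> chart_inv c)"
    using assms unfolding smooth_manifold_def by blast
  then have "Ck_on (Suc 0) (snd c ` (fst c \<inter> fst d)) (snd d \<circ> chart_inv c)"
    unfolding smooth_on_def by blast
  then have "(snd d \<circ> chart_inv c) differentiable (at (snd c g))"
    using assms(4,5) by auto
  then obtain D where "(snd d \<circ> chart_inv c has_derivative D) (at (snd c g))"
    unfolding differentiable_def by blast
  then show thesis
    using that[of "Blinfun D"] has_derivative_bounded_linear bounded_linear_Blinfun_apply by metis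
qed

lemma chart_transition_near:
  assumes "smooth_manifold A" "c \<in> A" "d \<in> A" "g \<in> fst c" "g \<in> fst d"
  shows "\<forall>\<^sub>F y in nhds (snd c g). y \<in> snd c ` fst c \<and> chart_inv d ((snd d \<circ> chart_inv c) y) = chart_inv c y"
proof -
  have "open (snd c ` (fst c \<inter> fst d))" using assms unfolding smooth_manifold_def by blast
  moreover have "snd c g \<in> snd c ` (fst c \<inter> fst d)" using assms by blast
  moreover have "y \<in> snd c ` fst c \<and> chart_inv d ((snd d \<circ> chart_inv c) y) = chart_inv c y" if y: "y \<in> snd c ` (fst c \<inter> fst d)" for y
  proof -
    obtain m where "y = snd c m" "m \<in> fst c" "m \<in> fst d" using y by blast
    then show ?thesis
      by (simp add: chart_inv_chart[OF atlas_charts_manifold[OF assms(1)]] assms(2,3))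
  qed
  ultimately show ?thesis unfolding eventually_nhds by blast
qed

text \<open>The two transition maps undo each other near the given points; differentiate.\<close>

lemma chart_transition_inverse:
  assumes A: "smooth_manifold A" and c: "c \<in> A" "g \<in> fst c" and d: "d \<in> A" "g \<in> fst d"
    and T: "(snd d \<circ> chart_inv c has_derivative blinfun_apply T) (at (snd c g))"
    and T': "(snd c \<circ> chart_inv d has_derivative blinfun_apply T') (at (snd d g))"
  shows "T' o\<^sub>L T = id_blinfun"
proof -
  note inv = chart_inv_chart[OF atlas_charts_manifold[OF A]]
  have "((snd c \<circ> chart_inv d) \<circ> (snd d \<circ> chart_inv c) has_derivative blinfun_apply T' \<circ> blinfun_apply T) (at (snd c g))"
    using T T' by (intro diff_chain_at) (simp_all add: inv[OF c])
  moreover have "\<forall>\<^sub>F y in nhds (snd c g). ((snd c \<circ> chart_inv d) \<circ> (snd d \<circ> chart_inv c)) y = y"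
    using chart_transition_near[OF A c(1) d(1) c(2) d(2)]
    by eventually_elim (auto simp: inv c)
  ultimately have "((\<lambda>y. y) has_derivative blinfun_apply T' \<circ> blinfun_apply T) (at (snd c g))"
    by (rule has_derivative_cong_nhds)
  then have "blinfun_apply T' \<circ> blinfun_apply T = (\<lambda>y. y)"
    by (rule has_derivative_unique[OF _ has_derivative_ident])
  then show ?thesis by (intro blinfun_eqI) (simp add: fun_eq_iff)
qed

text \<open>The factor by which a cotangent chart converts a covector into momentum coordinates is the
  derivative of the transition from \<open>c\<close> to the chosen chart at \<open>g\<close>, hence invertible. This makes
  the cotangent charts injective, with all of the dual space as momentum coordinates.\<close>

lemma tangent_map_chart_inv:
  assumes A: "smooth_manifold A" and c: "c \<in> A" "g \<in> fst c"
  obtains T T' where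
    "Blinfun (tangent_map model_atlas A (chart_inv c) (snd c g)) = T"
    "(snd c \<circ> chart_inv (chart_at A g) has_derivative blinfun_apply T') (at (snd (chart_at A g) g))"
    "T o\<^sub>L T' = id_blinfun" "T' o\<^sub>L T = id_blinfun"
proof -
  let ?d = "chart_at A g"
  have d: "?d \<in> A" "g \<in> fst ?d"
    using A by (auto intro!: chart_at_in_atlas simp: smooth_manifold_def)
  obtain T where T: "(snd ?d \<circ> chart_inv c has_derivative blinfun_apply T) (at (snd c g))"
    by (rule chart_transition_differentiable[OF A c(1) d(1) c(2) d(2)])
  obtain T' where T': "(snd c \<circ> chart_inv ?d has_derivative blinfun_apply T') (at (snd ?d g))"
    by (rule chart_transition_differentiable[OF A d(1) c(1) d(2) c(2)])
  have "tangent_map model_atlas A (chart_inv c) (snd c g) = blinfun_apply T"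
    using frechet_derivative_at[OF T]
    by (simp add: tangent_map_def chart_inv_chart[OF atlas_charts_manifold[OF A] c])
  then have "Blinfun (tangent_map model_atlas A (chart_inv c) (snd c g)) = T"
    by (simp add: blinfun_apply_inverse)
  then show thesis
    using that T' chart_transition_inverse[OF A c d T T'] chart_transition_inverse[OF A d c T' T]
    by blast
qed

text \<open>The differential is computed in the chosen chart at \<open>g\<close>, and the cotangent chart composes it with
  the derivative of the transition to that chart; by the chain rule the chosen chart cancels.\<close>

lemma differential_in_chart:
  assumes A: "smooth_manifold A" and c: "c \<in> A" "g \<in> fst c"
    and f: "(f \<circ> chart_inv c has_derivative blinfun_apply \<delta>) (at (snd c g))"
  shows "differential A f g o\<^sub>L Blinfun (tangent_map model_atlas A (chart_inv c) (snd c g)) = \<delta>"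
proof -
  let ?d = "chart_at A g"
  have d: "?d \<in> A" "g \<in> fst ?d"
    using A by (auto intro!: chart_at_in_atlas simp: smooth_manifold_def)
  obtain T T' where T: "Blinfun (tangent_map model_atlas A (chart_inv c) (snd c g)) = T"
    "(snd c \<circ> chart_inv ?d has_derivative blinfun_apply T') (at (snd ?d g))" "T' o\<^sub>L T = id_blinfun"
    by (rule tangent_map_chart_inv[OF A c])
  have "((f \<circ> chart_inv c) \<circ> (snd c \<circ> chart_inv ?d) has_derivative blinfun_apply \<delta> \<circ> blinfun_apply T') (at (snd ?d g))"
    using T(2) f by (intro diff_chain_at) (simp_all add: chart_inv_chart[OF atlas_charts_manifold[OF A] d])
  moreover have "\<forall>\<^sub>F y in nhds (snd ?d g). ((f \<circ> chart_inv c) \<circ> (snd c \<circ> chart_inv ?d)) y = (f \<circ> chart_inv ?d) y"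
    using chart_transition_near[OF A d(1) c(1) d(2) c(2)] by eventually_elim simp
  ultimately have "(f \<circ> chart_inv ?d has_derivative blinfun_apply \<delta> \<circ> blinfun_apply T') (at (snd ?d g))"
    by (rule has_derivative_cong_nhds)
  from frechet_derivative_at[OF this]
  have "tangent_map A model_atlas f g = blinfun_apply (\<delta> o\<^sub>L T')"
    by (simp add: tangent_map_def fun_eq_iff)
  then have "differential A f g = \<delta> o\<^sub>L T'"
    by (simp add: differential_def blinfun_apply_inverse)
  then show ?thesis
    by (simp add: T(1) blinfun_compose_assoc T(3))
qed

lemma cotangent_chart_image:
  fixes A :: "('m, 'e::real_normed_vector) chart set"
  assumes A: "smooth_manifold A" and c: "c \<in> A"
  shows "snd (cotangent_chart A c) ` fst (cotangent_chart A c) = snd c ` fst c \<times> UNIV"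
proof (intro set_eqI iffI)
  fix w assume "w \<in> snd c ` fst c \<times> (UNIV :: ('e \<Rightarrow>\<^sub>L real) set)"
  then obtain g where g: "g \<in> fst c" "fst w = snd c g" by auto
  obtain T T' where T: "Blinfun (tangent_map model_atlas A (chart_inv c) (snd c g)) = T" "T' o\<^sub>L T = id_blinfun"
    by (rule tangent_map_chart_inv[OF A c g(1)])
  have "snd (cotangent_chart A c) (g, snd w o\<^sub>L T') = w"
    by (simp add: cotangent_chart_def T blinfun_compose_assoc prod_eq_iff g(2))
  moreover have "(g, snd w o\<^sub>L T') \<in> fst (cotangent_chart A c)"
    using g(1) by (simp add: cotangent_chart_def)
  ultimately show "w \<in> snd (cotangent_chart A c) ` fst (cotangent_chart A c)" by (metis image_eqI)
qed (auto simp: cotangent_chart_def)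

lemma atlas_charts_cotangent:
  fixes A :: "('m, 'e::real_normed_vector) chart set"
  assumes A: "smooth_manifold A" shows "atlas_charts (cotangent_atlas A)"
  unfolding atlas_charts_def
proof (intro conjI ballI)
  show "(\<Union>c\<in>cotangent_atlas A. fst c) = UNIV"
  proof (intro set_eqI iffI UNIV_I)
    fix z :: "'m \<times> ('e \<Rightarrow>\<^sub>L real)"
    obtain c where "c \<in> A" "fst z \<in> fst c"
      using atlas_charts_cover[OF atlas_charts_manifold[OF A]] .
    then show "z \<in> (\<Union>c\<in>cotangent_atlas A. fst c)"
      by (auto simp: cotangent_atlas_def cotangent_chart_def mem_Times_iff)
  qed
  fix C assume "C \<in> cotangent_atlas A"
  then obtain c where c: "c \<in> A" and C: "C = cotangent_chart A c" by (auto simp: cotangent_atlas_def)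
  show "inj_on (snd C) (fst C)"
  proof (rule inj_onI)
    fix z z' assume z: "z \<in> fst C" "z' \<in> fst C" "snd C z = snd C z'"
    then have g: "fst z \<in> fst c" "fst z' \<in> fst c" "snd c (fst z) = snd c (fst z')"
      by (auto simp: C cotangent_chart_def split_beta)
    then have eq: "fst z = fst z'"
      using chart_inv_chart[OF atlas_charts_manifold[OF A] c] by metis
    obtain T T' where T: "Blinfun (tangent_map model_atlas A (chart_inv c) (snd c (fst z))) = T" "T o\<^sub>L T' = id_blinfun"
      by (rule tangent_map_chart_inv[OF A c g(1)])
    have "snd z o\<^sub>L T = snd z' o\<^sub>L T"
      using z(3) T(1) eq by (simp add: C cotangent_chart_def split_beta)
    then have "(snd z o\<^sub>L T) o\<^sub>L T' = (snd z' o\<^sub>L T) o\<^sub>L T'" by simp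
    then have "snd z = snd z'" by (simp add: blinfun_compose_assoc T(2))
    with eq show "z = z'" by (simp add: prod_eq_iff)
  qed
qed

text \<open>The tangent space at \<open>z\<close> is identified with the model space through the very cotangent chart in
  which the form is written, so the form is pulled back along the identity. Openness of the image of that chart is what
  makes its coordinate expression the identity on a whole neighbourhood.\<close>

lemma canonical_symplectic_form_eq:
  assumes A: "smooth_manifold A" shows "canonical_symplectic_form A z = dq_wedge_dp"
proof -
  let ?C = "chart_at (cotangent_atlas A) z"
  have C: "?C \<in> cotangent_atlas A" "z \<in> fst ?C"
    using atlas_charts_cotangent[OF A] by (auto intro!: chart_at_in_atlas simp: atlas_charts_def)
  then obtain c where c: "c \<in> A" "?C = cotangent_chart A c" by (auto simp: cotangent_atlas_def)
  have "open (snd ?C ` fst ?C)"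
    unfolding c(2) cotangent_chart_image[OF A c(1)]
    using A c(1) by (intro open_Times) (auto simp: smooth_manifold_def)
  then have "\<forall>\<^sub>F y in nhds (snd ?C z). y \<in> snd ?C ` fst ?C"
    using C(2) unfolding eventually_nhds by blast
  then have "\<forall>\<^sub>F y in nhds (snd ?C z). y = (snd ?C \<circ> chart_inv ?C) y"
    by eventually_elim (simp add: chart_inv_def f_inv_into_f)
  then have "(snd ?C \<circ> chart_inv ?C has_derivative (\<lambda>h. h)) (at (snd ?C z))"
    by (rule has_derivative_cong_nhds[OF has_derivative_ident])
  from frechet_derivative_at[OF this]
  have "tangent_map (cotangent_atlas A) model_atlas (snd ?C) z = (\<lambda>h. h)"
    by (simp add: tangent_map_def)
  then show ?thesis
    by (simp add: canonical_symplectic_form_def pullback_form_def fun_eq_iff)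
qed

section \<open>Symplectic maps from generating functions\<close>

text \<open>The heart of the proof, in coordinates. The momentum relations hold in a neighbourhood of \<open>w\<close>, so
  they may be differentiated; they express the momentum parts of a vector \<open>h\<close> and of its image \<open>L h\<close>
  by \<open>s''\<close> applied to the pair of base parts. The relations are phrased through whatever derivative
  \<open>\<delta>\<close> the function \<open>s\<close> has at the pair of base points, so that they can be stated pointwise.\<close>

lemma generating_function_preserves_dq_wedge_dp:
  fixes s :: "'e::real_normed_vector \<times> 'e \<Rightarrow> real"
    and \<Phi> :: "'e \<times> ('e \<Rightarrow>\<^sub>L real) \<Rightarrow> 'e \<times> ('e \<Rightarrow>\<^sub>L real)"
  assumes s: "twice_differentiable_at s (fst w, fst (\<Phi> w))"
    and \<Phi>: "(\<Phi> has_derivative L) (at w)"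
    and gen: "\<forall>\<^sub>F y in nhds w. \<forall>\<delta>. (s has_derivative blinfun_apply \<delta>) (at (fst y, fst (\<Phi> y))) \<longrightarrow>
       (\<forall>a. snd y a = - \<delta> (a, 0) \<and> snd (\<Phi> y) a = \<delta> (0, a))"
  shows "dq_wedge_dp (L u) (L v) = dq_wedge_dp u v"
proof -
  define q where "q y = (fst y, fst (\<Phi> y))" for y
  obtain s' where s': "\<forall>\<^sub>F x in nhds (q w). (s has_derivative blinfun_apply (s' x)) (at x)" "s' differentiable (at (q w))"
    using s unfolding twice_differentiable_at_def q_def by blast
  then obtain s'' where s'': "(s' has_derivative s'') (at (q w))"
    unfolding differentiable_def by blast
  have q: "(q has_derivative (\<lambda>h. (fst h, fst (L h)))) (at w)"
    unfolding q_def
    by (intro has_derivative_Pair has_derivative_fst has_derivative_ident \<Phi>)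
  have "\<forall>\<^sub>F y in nhds w. (s has_derivative blinfun_apply (s' (q y))) (at (q y))"
    using has_derivative_continuous[OF q] s'(1) by (rule isCont_eventually_nhds)
  with gen have mom: "\<forall>\<^sub>F y in nhds w. \<forall>a. blinfun_apply (snd y) a = - blinfun_apply (s' (q y)) (a, 0) \<and> blinfun_apply (snd (\<Phi> y)) a = blinfun_apply (s' (q y)) (0, a)"
    by eventually_elim (simp add: q_def)
  have dq: "((\<lambda>y. blinfun_apply (s' (q y)) b) has_derivative (\<lambda>h. blinfun_apply (s'' (fst h, fst (L h))) b)) (at w)" for b
    using bounded_linear.has_derivative[OF bounded_bilinear.bounded_linear_left[OF bounded_bilinear_blinfun_apply]
        has_derivative_compose[OF q s'']] .
  have init: "blinfun_apply (snd h) a = - blinfun_apply (s'' (fst h, fst (L h))) (a, 0)" for h a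
  proof -
    have "((\<lambda>y. - blinfun_apply (s' (q y)) (a, 0)) has_derivative (\<lambda>h. - blinfun_apply (s'' (fst h, fst (L h))) (a, 0))) (at w)"
      by (intro has_derivative_minus dq)
    then have "((\<lambda>y. blinfun_apply (snd y) a) has_derivative (\<lambda>h. - blinfun_apply (s'' (fst h, fst (L h))) (a, 0))) (at w)"
      by (rule has_derivative_cong_nhds) (use mom in \<open>auto elim: eventually_mono\<close>)
    moreover have "((\<lambda>y :: 'e \<times> ('e \<Rightarrow>\<^sub>L real). blinfun_apply (snd y) a) has_derivative (\<lambda>h. blinfun_apply (snd h) a)) (at w)"
      by (intro bounded_linear.has_derivative[OF bounded_bilinear.bounded_linear_left[OF bounded_bilinear_blinfun_apply]]
          has_derivative_snd has_derivative_ident)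
    ultimately show ?thesis using has_derivative_unique by (metis (no_types, lifting))
  qed
  have final: "blinfun_apply (snd (L h)) a = blinfun_apply (s'' (fst h, fst (L h))) (0, a)" for h a
  proof -
    have "((\<lambda>y. blinfun_apply (snd (\<Phi> y)) a) has_derivative (\<lambda>h. blinfun_apply (s'' (fst h, fst (L h))) (0, a))) (at w)"
      by (rule has_derivative_cong_nhds[OF dq]) (use mom in \<open>auto elim: eventually_mono\<close>)
    moreover have "((\<lambda>y. blinfun_apply (snd (\<Phi> y)) a) has_derivative (\<lambda>h. blinfun_apply (snd (L h)) a)) (at w)"
      by (intro bounded_linear.has_derivative[OF bounded_bilinear.bounded_linear_left[OF bounded_bilinear_blinfun_apply]]
          has_derivative_snd \<Phi>)
    ultimately show ?thesis using has_derivative_unique by (metis (no_types, lifting))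
  qed
  have split: "blinfun_apply \<beta> (a, 0) + blinfun_apply \<beta> (0, b) = blinfun_apply \<beta> (a, b)" for \<beta> :: "('e \<times> 'e) \<Rightarrow>\<^sub>L real" and a b
    by (simp add: blinfun.add_right[symmetric])
  have sym: "blinfun_apply (s'' (fst u, fst (L u))) (fst v, fst (L v)) = blinfun_apply (s'' (fst v, fst (L v))) (fst u, fst (L u))"
    by (rule second_derivative_symmetric[OF s'(1) s''])
  show ?thesis
    using sym split[of "s'' (fst u, fst (L u))" "fst v" "fst (L v)"] split[of "s'' (fst v, fst (L v))" "fst u" "fst (L u)"]
    by (simp add: dq_wedge_dp_def final init[of u "fst v"] init[of v "fst u"])
qed

text \<open>Fixing one endpoint restricts the coordinate expression of \<open>S\<close> on the product manifold to a
  slice, so the momentum coordinates of the two partial differentials are the two restrictions of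
  one derivative \<open>\<delta>\<close>.\<close>

lemma partial_differentials_in_charts:
  assumes A: "smooth_manifold A" and c: "c \<in> A" "a \<in> fst c" and d: "d \<in> A" "b \<in> fst d"
    and S: "(case_prod S \<circ> chart_inv (fst c \<times> fst d, map_prod (snd c) (snd d)) has_derivative blinfun_apply \<delta>)
              (at (snd c a, snd d b))"
  shows "blinfun_apply (differential A (\<lambda>x. S x b) a o\<^sub>L Blinfun (tangent_map model_atlas A (chart_inv c) (snd c a))) u
           = blinfun_apply \<delta> (u, 0)"
    and "blinfun_apply (differential A (\<lambda>y. S a y) b o\<^sub>L Blinfun (tangent_map model_atlas A (chart_inv d) (snd d b))) u
           = blinfun_apply \<delta> (0, u)"
proof -
  note charts = atlas_charts_manifold[OF A]
  note inv = chart_inv_chart[OF charts]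
  let ?s = "case_prod S \<circ> chart_inv (fst c \<times> fst d, map_prod (snd c) (snd d))"
  define inl inr where "inl = Blinfun (\<lambda>u::'b. (u, 0::'b))" and "inr = Blinfun (\<lambda>v::'b. (0::'b, v))"
  have bl[simp]: "blinfun_apply inl = (\<lambda>u. (u, 0))" "blinfun_apply inr = (\<lambda>v. (0, v))"
    unfolding inl_def inr_def
    by (intro bounded_linear_Blinfun_apply bounded_linear_intros | simp)+
  have dinl: "blinfun_apply (\<delta> o\<^sub>L inl) = (\<lambda>h. \<delta> (h, 0))"
    and dinr: "blinfun_apply (\<delta> o\<^sub>L inr) = (\<lambda>h. \<delta> (0, h))" by auto
  have "((\<lambda>x. ?s (x, snd d b)) has_derivative (\<lambda>h. \<delta> (h, 0))) (at (snd c a))"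
    by (rule has_derivative_compose[OF has_derivative_Pair[OF has_derivative_ident has_derivative_const] S])
  moreover have "\<forall>\<^sub>F x in nhds (snd c a). ?s (x, snd d b) = ((\<lambda>x. S x b) \<circ> chart_inv c) x"
    using chart_domain_nhds[OF A c]
    by eventually_elim (use d in \<open>simp add: chart_inv_prod[OF charts c(1) _ charts d(1)] inv\<close>)
  ultimately have "((\<lambda>x. S x b) \<circ> chart_inv c has_derivative (\<lambda>h. \<delta> (h, 0))) (at (snd c a))"
    by (rule has_derivative_cong_nhds)
  then have "((\<lambda>x. S x b) \<circ> chart_inv c has_derivative blinfun_apply (\<delta> o\<^sub>L inl)) (at (snd c a))"
    by (simp only: dinl)
  from differential_in_chart[OF A c this]
  show "blinfun_apply (differential A (\<lambda>x. S x b) a o\<^sub>L Blinfun (tangent_map model_atlas A (chart_inv c) (snd c a))) u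
           = blinfun_apply \<delta> (u, 0)" by simp
  have "((\<lambda>y. ?s (snd c a, y)) has_derivative (\<lambda>h. \<delta> (0, h))) (at (snd d b))"
    by (rule has_derivative_compose[OF has_derivative_Pair[OF has_derivative_const has_derivative_ident] S])
  moreover have "\<forall>\<^sub>F y in nhds (snd d b). ?s (snd c a, y) = ((\<lambda>y. S a y) \<circ> chart_inv d) y"
    using chart_domain_nhds[OF A d]
    by eventually_elim (use c in \<open>simp add: chart_inv_prod[OF charts c(1) _ charts d(1)] inv\<close>)
  ultimately have "((\<lambda>y. S a y) \<circ> chart_inv d has_derivative (\<lambda>h. \<delta> (0, h))) (at (snd d b))"
    by (rule has_derivative_cong_nhds)
  then have "((\<lambda>y. S a y) \<circ> chart_inv d has_derivative blinfun_apply (\<delta> o\<^sub>L inr)) (at (snd d b))"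
    by (simp only: dinr)
  from differential_in_chart[OF A d this]
  show "blinfun_apply (differential A (\<lambda>y. S a y) b o\<^sub>L Blinfun (tangent_map model_atlas A (chart_inv d) (snd d b))) u
           = blinfun_apply \<delta> (0, u)" by simp
qed

text \<open>The globalisation of the computation in coordinates: around a point \<open>z\<close> of the domain and its
  image, the canonical charts put the map and the generating relations into the form required
  there.\<close>

lemma symplectic_on_if_generated:
  fixes A :: "('m, 'e::real_normed_vector) chart set"
  assumes A: "smooth_manifold A"
    and F: "smooth_map_on (cotangent_atlas A) (cotangent_atlas A) D F"
    and gen: "\<And>a p. (a, p) \<in> D \<Longrightarrow>
       p = - differential A (\<lambda>x. S x (fst (F (a, p)))) a \<and>
       snd (F (a, p)) = differential A (\<lambda>y. S a y) (fst (F (a, p)))"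
    and S: "\<And>a p. (a, p) \<in> D \<Longrightarrow> twice_differentiable_map_at (prod_atlas A A) model_atlas (case_prod S) (a, fst (F (a, p)))"
  shows "symplectic_on A D F"
  unfolding symplectic_on_def
proof (intro ballI ext)
  fix z u v assume z: "z \<in> D"
  let ?TA = "cotangent_atlas A"
  let ?C = "chart_at ?TA z" and ?C' = "chart_at ?TA (F z)"
  have TA: "atlas_charts ?TA" by (rule atlas_charts_cotangent[OF A])
  have C: "?C \<in> ?TA" "z \<in> fst ?C" "?C' \<in> ?TA" "F z \<in> fst ?C'"
    using TA by (auto intro!: chart_at_in_atlas simp: atlas_charts_def)
  then obtain c c' where c: "c \<in> A" "?C = cotangent_chart A c" and c': "c' \<in> A" "?C' = cotangent_chart A c'"
    unfolding cotangent_atlas_def by blast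
  define \<Phi> where "\<Phi> = snd ?C' \<circ> F \<circ> chart_inv ?C"
  define s where "s = case_prod S \<circ> chart_inv (fst c \<times> fst c', map_prod (snd c) (snd c'))"
  obtain X where X: "open X" "snd ?C z \<in> X" "Ck_on (Suc 0) X \<Phi>"
    "\<forall>y\<in>X. y \<in> snd ?C ` fst ?C \<and> chart_inv ?C y \<in> D \<and> F (chart_inv ?C y) \<in> fst ?C'"
    using smooth_map_on_coordinates[OF F TA C(1,3) z C(2,4), where k = "Suc 0"] unfolding \<Phi>_def .
  have L: "(\<Phi> has_derivative frechet_derivative \<Phi> (at (snd ?C z))) (at (snd ?C z))"
    using X(2,3) by (auto simp: frechet_derivative_works)
  have point: "fst m \<in> fst c" "fst (F m) \<in> fst c'"
      "snd ?C m = (snd c (fst m), snd m o\<^sub>L Blinfun (tangent_map model_atlas A (chart_inv c) (snd c (fst m))))"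
      "\<Phi> (snd ?C m) = (snd c' (fst (F m)), snd (F m) o\<^sub>L Blinfun (tangent_map model_atlas A (chart_inv c') (snd c' (fst (F m)))))"
    if m: "m \<in> fst ?C" "F m \<in> fst ?C'" for m
    using m unfolding \<Phi>_def comp_apply chart_inv_chart[OF TA C(1) m(1)]
    by (auto simp: c(2) c'(2) cotangent_chart_def split_beta)
  have "dq_wedge_dp (frechet_derivative \<Phi> (at (snd ?C z)) u) (frechet_derivative \<Phi> (at (snd ?C z)) v) = dq_wedge_dp u v"
  proof (rule generating_function_preserves_dq_wedge_dp[OF _ L])
    let ?cc = "(fst c \<times> fst c', map_prod (snd c) (snd c'))"
    have "?cc \<in> prod_atlas A A" using c(1) c'(1) unfolding prod_atlas_def by force
    moreover have "(fst z, fst (F z)) \<in> fst ?cc" using point[OF C(2,4)] by simp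
    moreover have "twice_differentiable_map_at (prod_atlas A A) model_atlas (case_prod S) (fst z, fst (F z))"
      using S[of "fst z" "snd z"] z by simp
    ultimately have "twice_differentiable_at s (snd ?cc (fst z, fst (F z)))"
      unfolding s_def twice_differentiable_map_at_model by blast
    moreover have "(fst (snd ?C z), fst (\<Phi> (snd ?C z))) = snd ?cc (fst z, fst (F z))"
      unfolding point(4)[OF C(2,4)] by (simp add: point(3)[OF C(2,4)])
    ultimately show "twice_differentiable_at s (fst (snd ?C z), fst (\<Phi> (snd ?C z)))" by simp
    have "\<forall>\<delta>. (s has_derivative blinfun_apply \<delta>) (at (fst y, fst (\<Phi> y))) \<longrightarrow>
       (\<forall>a. blinfun_apply (snd y) a = - blinfun_apply \<delta> (a, 0) \<and> blinfun_apply (snd (\<Phi> y)) a = blinfun_apply \<delta> (0, a))"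
      if y: "y \<in> X" for y
    proof (intro allI impI)
      fix \<delta> a assume \<delta>: "(s has_derivative blinfun_apply \<delta>) (at (fst y, fst (\<Phi> y)))"
      obtain m where m: "m \<in> fst ?C" "y = snd ?C m" using X(4) y by blast
      then have m': "m \<in> D" "F m \<in> fst ?C'"
        using X(4) y chart_inv_chart[OF TA C(1) m(1)] by auto
      note pt = point(1,2)[OF m(1) m'(2)] point(3,4)[OF m(1) m'(2), folded m(2)]
      have "(s has_derivative blinfun_apply \<delta>) (at (snd c (fst m), snd c' (fst (F m))))"
        using \<delta> unfolding pt(4) by (simp add: pt(3))
      note part = partial_differentials_in_charts[OF A c(1) pt(1) c'(1) pt(2) this[unfolded s_def]]
      have g: "snd m = - differential A (\<lambda>x. S x (fst (F m))) (fst m)"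
        "snd (F m) = differential A (\<lambda>y. S (fst m) y) (fst (F m))"
        using gen[of "fst m" "snd m"] m'(1) by auto
      show "blinfun_apply (snd y) a = - blinfun_apply \<delta> (a, 0) \<and> blinfun_apply (snd (\<Phi> y)) a = blinfun_apply \<delta> (0, a)"
        unfolding pt(4) using part[of a] g by (simp add: pt(3) bounded_bilinear.minus_left[OF bounded_bilinear_blinfun_compose] blinfun.minus_left)
    qed
    then show "\<forall>\<^sub>F y in nhds (snd ?C z). \<forall>\<delta>. (s has_derivative blinfun_apply \<delta>) (at (fst y, fst (\<Phi> y))) \<longrightarrow>
       (\<forall>a. blinfun_apply (snd y) a = - blinfun_apply \<delta> (a, 0) \<and> blinfun_apply (snd (\<Phi> y)) a = blinfun_apply \<delta> (0, a))"
      using X(1,2) unfolding eventually_nhds by blast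
  qed
  then show "pullback_form ?TA ?TA F (canonical_symplectic_form A) z u v = canonical_symplectic_form A z u v"
    by (simp add: pullback_form_def canonical_symplectic_form_eq[OF A] tangent_map_def \<Phi>_def)
qed

section \<open>The discrete action as a generating function\<close>

lemma stochastic_hamiltonian_twice_differentiable:
  fixes A :: "('g, 'e::euclidean_space) chart set" and h :: "'g \<times> ('e \<Rightarrow>\<^sub>L real) \<Rightarrow> real"
  assumes A: "atlas_charts A"
    and h: "smooth_map_on (prod_atlas A model_atlas) model_atlas UNIV h"
    and hs: "\<And>i. i \<in> {1..N} \<Longrightarrow> smooth_map_on (prod_atlas A model_atlas) model_atlas UNIV (hs i)"
  shows "twice_differentiable_map_at (prod_atlas A model_atlas) model_atlas
           (stochastic_hamiltonian h hs N \<Delta>t \<Delta>W k) z"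
proof -
  note AM = atlas_charts_prod[OF A atlas_charts_model]
  note smooth = smooth_map_on_twice_differentiable_at[OF
      has_finite_frame_prod[OF has_finite_frame_euclidean has_finite_frame_dual] AM _ UNIV_I]
  show ?thesis
    unfolding stochastic_hamiltonian_def
    by (intro twice_differentiable_map_at_add twice_differentiable_map_at_sum AM smooth h hs
        bounded_linear_twice_differentiable_map_at[OF bounded_linear_mult_left])
qed

text \<open>The action of the family of critical curves is built from the components of the curve by group
  operations, the inverse retraction map, the pairing of momenta with velocities and the
  Hamiltonian. The retraction condition on each curve keeps the group differences in the open set
  where the inverse retraction map is smooth.\<close>

lemma generating_function_twice_differentiable:
  fixes G :: "('g, 'e::euclidean_space) lie_group_data"
  assumes G: "lie_group G" and \<tau>: "lie_retraction G \<tau> U"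
    and H: "\<And>k z. k \<in> {1..M} \<Longrightarrow> twice_differentiable_map_at (prod_atlas (atlas G) model_atlas) model_atlas (H k) z"
    and cbar: "critical_curve_family G \<tau> U \<Delta>t M H E cbar"
    and E: "(a, b) \<in> E"
  shows "twice_differentiable_map_at (prod_atlas (atlas G) (atlas G)) model_atlas
           (\<lambda>(a, b). generating_function G \<tau> U \<Delta>t M H cbar a b) (a, b)"
proof -
  let ?A = "atlas G" and ?z = "(a, b)"
  let ?A2 = "prod_atlas ?A ?A"
  have A: "atlas_charts ?A" using G by (simp add: lie_group_def atlas_charts_manifold)
  then have A2: "atlas_charts ?A2" by (simp add: atlas_charts_prod)
  note frame = has_finite_frame_euclidean[where 'a='e]
  note frame2 = has_finite_frame_prod[OF frame frame]
  have node: "twice_differentiable_map_at ?A2 ?A (\<lambda>x. node (cbar x) k) ?z" if "k \<le> M" for k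
    using cbar that E unfolding critical_curve_family_def Let_def
    by (intro smooth_map_on_twice_differentiable_at[OF frame2 A2, where S = E]) auto
  have midnode: "twice_differentiable_map_at ?A2 ?A (\<lambda>x. midnode (cbar x) k) ?z"
    and mom1: "twice_differentiable_map_at ?A2 model_atlas (\<lambda>x. mom1 (cbar x) k) ?z"
    and mom2: "twice_differentiable_map_at ?A2 model_atlas (\<lambda>x. mom2 (cbar x) k) ?z" if "k \<in> {1..M}" for k
    using cbar that E unfolding critical_curve_family_def Let_def
    by (auto intro!: smooth_map_on_twice_differentiable_at[OF frame2 A2, where S = E])
  have mult: "twice_differentiable_map_at ?A2 ?A (\<lambda>(a, b). mult G a b) z" for z
    using G by (intro smooth_map_on_twice_differentiable_at[OF frame2 A2, where S = UNIV]) (auto simp: lie_group_def)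
  have inv: "twice_differentiable_map_at ?A ?A (inverse_of G) z" for z
    using G by (intro smooth_map_on_twice_differentiable_at[OF frame A, where S = UNIV]) (auto simp: lie_group_def)
  have inv_tau: "twice_differentiable_map_at ?A model_atlas (inv_into U \<tau>) z" if "z \<in> \<tau> ` U" for z
    using \<tau> that by (intro smooth_map_on_twice_differentiable_at[OF frame A, where S = "\<tau> ` U"]) (auto simp: lie_retraction_def)
  have diff_quot: "twice_differentiable_map_at ?A2 model_atlas
      (\<lambda>x. inv_into U \<tau> (mult G (inverse_of G (f x)) (g x)) /\<^sub>R \<Delta>t) ?z"
    if f: "twice_differentiable_map_at ?A2 ?A f ?z" and g: "twice_differentiable_map_at ?A2 ?A g ?z"
      and r: "mult G (inverse_of G (f ?z)) (g ?z) \<in> \<tau> ` U" for f g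
  proof -
    have "twice_differentiable_map_at ?A2 ?A (\<lambda>x. inverse_of G (f x)) ?z"
      by (rule twice_differentiable_map_at_compose[OF A f inv A2])
    from twice_differentiable_map_at_compose[OF A2 twice_differentiable_map_at_Pair[OF this g] mult A2]
    have m: "twice_differentiable_map_at ?A2 ?A (\<lambda>x. mult G (inverse_of G (f x)) (g x)) ?z" by simp
    show ?thesis
      by (rule bounded_linear_twice_differentiable_map_at[OF bounded_linear_scaleR_right A2
            twice_differentiable_map_at_compose[OF A m inv_tau[OF r] A2]])
  qed
  have range: "in_retraction_range G \<tau> U M (cbar ?z)"
    using cbar E unfolding critical_curve_family_def critical_discrete_curve_def Let_def by blast
  have "twice_differentiable_map_at ?A2 model_atlas (\<lambda>c. discrete_action G \<tau> U \<Delta>t M H (cbar c)) ?z"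
    unfolding discrete_action_def
  proof (rule twice_differentiable_map_at_sum[OF A2])
    fix k assume k: "k \<in> {1..M}"
    have r: "mult G (inverse_of G (midnode (cbar ?z) k)) (node (cbar ?z) k) \<in> \<tau> ` U"
      "mult G (inverse_of G (node (cbar ?z) (k - 1))) (midnode (cbar ?z) k) \<in> \<tau> ` U"
      using range k unfolding in_retraction_range_def by blast+
    have kM: "k \<le> M" "k - 1 \<le> M" using k by auto
    have mean: "twice_differentiable_map_at ?A2 model_atlas (\<lambda>c. (mom1 (cbar c) k + mom2 (cbar c) k) /\<^sub>R 2) ?z"
      by (rule bounded_linear_twice_differentiable_map_at[OF bounded_linear_scaleR_right A2
            twice_differentiable_map_at_add[OF A2 mom1[OF k] mom2[OF k]]])
    have "twice_differentiable_map_at ?A2 model_atlas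
        (\<lambda>c. H k (midnode (cbar c) k, (mom1 (cbar c) k + mom2 (cbar c) k) /\<^sub>R 2)) ?z"
      by (rule twice_differentiable_map_at_compose[OF atlas_charts_prod[OF A atlas_charts_model]
            twice_differentiable_map_at_Pair[OF midnode[OF k] mean] H[OF k] A2])
    then show "twice_differentiable_map_at ?A2 model_atlas (\<lambda>c. \<Delta>t *
        (blinfun_apply (mom2 (cbar c) k)
           (inv_into U \<tau> (mult G (inverse_of G (midnode (cbar c) k)) (node (cbar c) k)) /\<^sub>R \<Delta>t)
         + blinfun_apply (mom1 (cbar c) k)
             (inv_into U \<tau> (mult G (inverse_of G (node (cbar c) (k - 1))) (midnode (cbar c) k)) /\<^sub>R \<Delta>t)
         - H k (midnode (cbar c) k, (mom1 (cbar c) k + mom2 (cbar c) k) /\<^sub>R 2))) ?z"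
      by (intro bounded_linear_twice_differentiable_map_at[OF bounded_linear_mult_right A2]
          A2 twice_differentiable_map_at_diff twice_differentiable_map_at_add
          bounded_bilinear.twice_differentiable_map_at[OF bounded_bilinear_blinfun_apply A2]
          mom1 mom2 diff_quot node midnode k kM r)
  qed
  then show ?thesis by (simp add: generating_function_def split_def)
qed

theorem proposition3p4:
  fixes G :: "('g, 'e::euclidean_space) lie_group_data"
    and \<tau> :: "'e \<Rightarrow> 'g" and U :: "'e set"
    and h :: "'g \<times> ('e \<Rightarrow>\<^sub>L real) \<Rightarrow> real"
    and hs :: "nat \<Rightarrow> 'g \<times> ('e \<Rightarrow>\<^sub>L real) \<Rightarrow> real"
    and N M :: nat and \<Delta>t :: real
    and P :: "'w measure" and W :: "nat \<Rightarrow> real \<Rightarrow> 'w \<Rightarrow> real" and \<omega> :: 'w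
    and H :: "nat \<Rightarrow> 'g \<times> ('e \<Rightarrow>\<^sub>L real) \<Rightarrow> real"
    and E :: "('g \<times> 'g) set"
    and cbar :: "'g \<times> 'g \<Rightarrow> ('g, 'e \<Rightarrow>\<^sub>L real) discrete_curve"
    and D :: "('g \<times> ('e \<Rightarrow>\<^sub>L real)) set"
    and F :: "'g \<times> ('e \<Rightarrow>\<^sub>L real) \<Rightarrow> 'g \<times> ('e \<Rightarrow>\<^sub>L real)"
  assumes "lie_group G"
    and "lie_retraction G \<tau> U"
    and "smooth_map_on (prod_atlas (atlas G) model_atlas) model_atlas UNIV h"
    and "\<And>i. i \<in> {1..N} \<Longrightarrow>
           smooth_map_on (prod_atlas (atlas G) model_atlas) model_atlas UNIV (hs i)"
    and "\<Delta>t > 0" and "M \<ge> 1"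
    and "prob_space P" and "independent_wiener_processes P N W" and "\<omega> \<in> space P"
    and "H = stochastic_hamiltonian h hs N \<Delta>t (wiener_increment W \<Delta>t \<omega>)"
    and "critical_curve_family G \<tau> U \<Delta>t M H E cbar"
    and "discrete_flow G \<tau> U \<Delta>t M H E cbar D F"
  shows "symplectic_on (atlas G) D F"
proof -
  let ?S = "generating_function G \<tau> U \<Delta>t M H cbar"
  have A: "smooth_manifold (atlas G)" using assms(1) by (simp add: lie_group_def)
  have F: "smooth_map_on (cotangent_atlas (atlas G)) (cotangent_atlas (atlas G)) D F"
    using assms(12) by (simp add: discrete_flow_def Let_def)
  have flow: "(a, fst (F (a, p))) \<in> E \<and> p = initial_momentum G ?S a (fst (F (a, p))) \<and>
      snd (F (a, p)) = final_momentum G ?S a (fst (F (a, p)))" if "(a, p) \<in> D" for a p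
    using assms(12) that unfolding discrete_flow_def Let_def by (metis prod.collapse)
  have H: "twice_differentiable_map_at (prod_atlas (atlas G) model_atlas) model_atlas (H k) z" for k z
    unfolding assms(10)
    by (rule stochastic_hamiltonian_twice_differentiable[OF atlas_charts_manifold[OF A] assms(3,4)])
  show ?thesis
  proof (rule symplectic_on_if_generated[OF A F, where S = ?S])
    fix a p assume z: "(a, p) \<in> D"
    show "p = - differential (atlas G) (\<lambda>x. ?S x (fst (F (a, p)))) a \<and>
       snd (F (a, p)) = differential (atlas G) (\<lambda>y. ?S a y) (fst (F (a, p)))"
      using flow[OF z] unfolding initial_momentum_def final_momentum_def by blast
    show "twice_differentiable_map_at (prod_atlas (atlas G) (atlas G)) model_atlas (case_prod ?S) (a, fst (F (a, p)))"
      using generating_function_twice_differentiable[OF assms(1,2) H assms(11)] flow[OF z] by simp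
  qed
qed

end
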